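(* Consider the open-road closed-loop system described in the context and let $$E_S=\left\{(s,v)\in\mathbb{R}^{2n-1}: s_i\ge\lambda,\ i=2,\dots,n,\ \ v_i=v^*,\ i=1,\dots,n\right\}.$$ Then there exist functions $\bar\sigma\in KL$ and $\bar a\in K_\infty$ such that every solution $(s(t),v(t))\in\Omega_S$ of the closed-loop system is defined for all $t\ge 0$ and satisfies for all $t\ge 0$ $$\bar a\big(\mathrm{dist}((s(t),v(t)),E_S)\big)\le H_S(s(t),v(t))\le\bar\sigma\big(H_S(s(0),v(0)),t\big).$$
   Context: Notation: $\mathbb{R}_+=[0,+\infty)$; $\mathrm{dist}$ is Euclidean distance to a set. Class $K$: increasing continuous $a:\mathbb{R}_+\to\mathbb{R}_+$ with $a(0)=0$; class $K_\infty$: those $a\in K$ with $\lim_{s\to+\infty}a(s)=+\infty$; class $KL$: continuous $\sigma:\mathbb{R}_+\times\mathbb{R}_+\to\mathbb{R}_+$ with $\sigma(\cdot,t)\in K$ for each $t\ge0$ and $\sigma(s,\cdot)$ non-increasing with $\lim_{t\to+\infty}\sigma(s,t)=0$ for each $s\ge 0$. Constants: integer $n\ge 2$; $\lambda>L>0$; $v_{\max}>0$; $v^*\in(0,v_{\max})$; $\mu>0$. Functions: $V\in C^3((L,+\infty);\mathbb{R}_+)$ satisfies $\lim_{x\to L^+}V(x)=+\infty$, $V(x)=0$ for $x\ge\lambda$, and $V'(x)<0$, $V''(x)>0$ for $x\in(L,\lambda)$. $b:\mathbb{R}\to(v^*-v_{\max},v^* )$ is $C^2$ and increasing, with $b(0)=0$,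 $xb(x)>0$ for $x\ne 0$, and $b'(0)>0$. State: $s=(s_2,\dots,s_n)\in\mathbb{R}^{n-1}$, $v=(v_1,\dots,v_n)\in\mathbb{R}^n$, with the convention $s_1=s_{n+1}=+\infty$ and $V'(s_1)=V''(s_1)=V'(s_{n+1})=V''(s_{n+1})=0$ (so terms involving $v_0$ or $v_{n+1}$ below are multiplied by zero and vanish). State space (open set): $$\Omega_S=\Big\{(s,v)\in\mathbb{R}^{2n-1}:\ \min_{i=2,\dots,n}s_i>L,\ \max_{i=1,\dots,n}v_i<v_{\max},\ \min_{i=1,\dots,n}v_i>0\Big\}.$$ Define, for $i=1,\dots,n$, $$f_i(s)=v^*-b\big(V'(s_{i+1})-V'(s_i)\big),$$ $$Z_i(s,v)=-v_{\max}^2\,b'\big(V'(s_{i+1})-V'(s_i)\big)\big(V''(s_{i+1})(v_i-v_{i+1})-V''(s_i)(v_{i-1}-v_i)\big),$$ and for $w,y\in(0,v_{\max})$ $$\beta(w,y)=\frac{v_{\max}^3(w+y)-2v_{\max}^2yw}{2(v_{\max}-w)^2w^2}\ (>0).$$ The open-road closed-loop system on $\Omega_S$ is $$\dot{s}_i=v_{i-1}-v_i,\ i=2,\dots,n,\qquad \dot{v}_i=F_i,\ i=1,\dots,n,$$ $$F_i=\frac{1}{\beta(v_i,f_i(s))}\left(\frac{Z_i(s,v)-\mu v_{\max}^2(v_i-f_i(s))}{v_i(v_{\max}-v_i)}+V'(s_i)-V'(s_{i+1})\right).$$ The function $H_S:\Omega_S\to\mathbb{R}_+$ is $$H_S(s,v)=\frac{v_{\max}^2}{2}\sum_{i=1}^n\frac{(v_i-f_i(s))^2}{v_i(v_{\max}-v_i)}+\sum_{i=2}^nV(s_i).$$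 *)

theory Defs
  imports "HOL-Analysis.Analysis"
begin

definition C_k_on :: "nat \<Rightarrow> (real \<Rightarrow> real) \<Rightarrow> real set \<Rightarrow> bool" where
  "C_k_on k f U \<longleftrightarrow>
     (\<forall>j<k. \<forall>x\<in>U. (deriv ^^ j) f field_differentiable at x) \<and> continuous_on U ((deriv ^^ k) f)"

text \<open>Functions on \<open>[0, \<infinity>)\<close> are total functions on the reals of which only the values on
  \<open>{0..}\<close> matter. ``Increasing'' is read as strictly increasing.\<close>

definition class_K :: "(real \<Rightarrow> real) \<Rightarrow> bool" where
  "class_K a \<longleftrightarrow>
     a ` {0..} \<subseteq> {0..} \<and> continuous_on {0..} a \<and> strict_mono_on {0..} a \<and> a 0 = 0"

definition class_K_inf :: "(real \<Rightarrow> real) \<Rightarrow> bool" where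
  "class_K_inf a \<longleftrightarrow> class_K a \<and> filterlim a at_top at_top"

definition class_KL :: "(real \<Rightarrow> real \<Rightarrow> real) \<Rightarrow> bool" where
  "class_KL \<sigma> \<longleftrightarrow>
     continuous_on ({0..} \<times> {0..}) (\<lambda>(r, t). \<sigma> r t) \<and>
     (\<forall>t\<ge>0. class_K (\<lambda>r. \<sigma> r t)) \<and>
     (\<forall>r\<ge>0. antimono_on {0..} (\<sigma> r) \<and> (\<sigma> r \<longlongrightarrow> 0) at_top)"

text \<open>A state \<open>(s, v)\<close> in \<open>\<real>\<^sup>2\<^sup>n\<^sup>-\<^sup>1\<close> is a pair of functions on the naturals of which only the components
  \<open>s i\<close> for \<open>i \<in> {2..n}\<close> and \<open>v i\<close> for \<open>i \<in> {1..n}\<close> matter; no definition below depends on the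
  other components (\<open>v 0\<close> and \<open>v (n + 1)\<close> occur only with the factor \<open>0\<close>).\<close>

type_synonym vec = "nat \<Rightarrow> real"

definition state_dist :: "nat \<Rightarrow> vec \<times> vec \<Rightarrow> vec \<times> vec \<Rightarrow> real" where
  "state_dist n x y =
     sqrt ((\<Sum>i=2..n. (fst x i - fst y i)\<^sup>2) + (\<Sum>i=1..n. (snd x i - snd y i)\<^sup>2))"

definition dist_to :: "nat \<Rightarrow> vec \<times> vec \<Rightarrow> (vec \<times> vec) set \<Rightarrow> real" where
  "dist_to n x E = (INF y\<in>E. state_dist n x y)"

definition state_space :: "nat \<Rightarrow> real \<Rightarrow> real \<Rightarrow> (vec \<times> vec) set" where
  "state_space n L vmax =
     {(s, v). (\<forall>i\<in>{2..n}. L < s i) \<and> (\<forall>i\<in>{1..n}. 0 < v i \<and> v i < vmax)}"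

definition equilibria :: "nat \<Rightarrow> real \<Rightarrow> real \<Rightarrow> (vec \<times> vec) set" where
  "equilibria n lam vstar = {(s, v). (\<forall>i\<in>{2..n}. lam \<le> s i) \<and> (\<forall>i\<in>{1..n}. v i = vstar)}"

text \<open>\<open>V'(s\<^sub>i)\<close> and \<open>V''(s\<^sub>i)\<close>, with the convention \<open>s\<^sub>1 = s\<^sub>n\<^sub>+\<^sub>1 = +\<infinity>\<close>, under which both vanish.\<close>

definition dV :: "nat \<Rightarrow> (real \<Rightarrow> real) \<Rightarrow> vec \<Rightarrow> nat \<Rightarrow> real" where
  "dV n V s i = (if i \<in> {2..n} then deriv V (s i) else 0)"

definition ddV :: "nat \<Rightarrow> (real \<Rightarrow> real) \<Rightarrow> vec \<Rightarrow> nat \<Rightarrow> real" where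
  "ddV n V s i = (if i \<in> {2..n} then deriv (deriv V) (s i) else 0)"

definition f_fun ::
    "nat \<Rightarrow> real \<Rightarrow> (real \<Rightarrow> real) \<Rightarrow> (real \<Rightarrow> real) \<Rightarrow> vec \<Rightarrow> nat \<Rightarrow> real" where
  "f_fun n vstar V b s i = vstar - b (dV n V s (i + 1) - dV n V s i)"

definition Z_fun ::
    "nat \<Rightarrow> real \<Rightarrow> (real \<Rightarrow> real) \<Rightarrow> (real \<Rightarrow> real) \<Rightarrow> vec \<Rightarrow> vec \<Rightarrow> nat \<Rightarrow> real" where
  "Z_fun n vmax V b s v i =
     - vmax\<^sup>2 * deriv b (dV n V s (i + 1) - dV n V s i) *
       (ddV n V s (i + 1) * (v i - v (i + 1)) - ddV n V s i * (v (i - 1) - v i))"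

definition beta :: "real \<Rightarrow> real \<Rightarrow> real \<Rightarrow> real" where
  "beta vmax w y =
     (vmax ^ 3 * (w + y) - 2 * vmax\<^sup>2 * y * w) / (2 * (vmax - w)\<^sup>2 * w\<^sup>2)"

definition F_fun ::
    "nat \<Rightarrow> real \<Rightarrow> real \<Rightarrow> real \<Rightarrow> (real \<Rightarrow> real) \<Rightarrow> (real \<Rightarrow> real) \<Rightarrow> vec \<Rightarrow> vec \<Rightarrow> nat \<Rightarrow> real" where
  "F_fun n vmax vstar \<mu> V b s v i =
     1 / beta vmax (v i) (f_fun n vstar V b s i) *
     ((Z_fun n vmax V b s v i - \<mu> * vmax\<^sup>2 * (v i - f_fun n vstar V b s i)) / (v i * (vmax - v i))
      + dV n V s i - dV n V s (i + 1))"

definition H_fun ::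
    "nat \<Rightarrow> real \<Rightarrow> real \<Rightarrow> (real \<Rightarrow> real) \<Rightarrow> (real \<Rightarrow> real) \<Rightarrow> vec \<Rightarrow> vec \<Rightarrow> real" where
  "H_fun n vmax vstar V b s v =
     vmax\<^sup>2 / 2 * (\<Sum>i=1..n. (v i - f_fun n vstar V b s i)\<^sup>2 / (v i * (vmax - v i)))
     + (\<Sum>i=2..n. V (s i))"

text \<open>Solutions staying in the state space, on an arbitrary interval \<open>I \<subseteq> [0, \<infinity>)\<close> containing \<open>0\<close>
  (derivatives are one-sided at endpoints belonging to \<open>I\<close>). The degenerate interval \<open>{0}\<close> is
  allowed: there the differential equation is void, so a maximal solution on \<open>{0}\<close> would be an
  initial state from which no solution starts.\<close>

definition closed_loop_solution ::
    "nat \<Rightarrow> real \<Rightarrow> real \<Rightarrow> real \<Rightarrow> real \<Rightarrow> (real \<Rightarrow> real) \<Rightarrow> (real \<Rightarrow> real) \<Rightarrow>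
     real set \<Rightarrow> (real \<Rightarrow> vec) \<Rightarrow> (real \<Rightarrow> vec) \<Rightarrow> bool" where
  "closed_loop_solution n L vmax vstar \<mu> V b I s v \<longleftrightarrow>
     is_interval I \<and> 0 \<in> I \<and> I \<subseteq> {0..} \<and>
     (\<forall>t\<in>I. (s t, v t) \<in> state_space n L vmax \<and>
        (\<forall>i\<in>{2..n}. ((\<lambda>\<tau>. s \<tau> i) has_real_derivative v t (i - 1) - v t i) (at t within I)) \<and>
        (\<forall>i\<in>{1..n}. ((\<lambda>\<tau>. v \<tau> i) has_real_derivative F_fun n vmax vstar \<mu> V b (s t) (v t) i)
                       (at t within I)))"

definition maximal_closed_loop_solution ::
    "nat \<Rightarrow> real \<Rightarrow> real \<Rightarrow> real \<Rightarrow> real \<Rightarrow> (real \<Rightarrow> real) \<Rightarrow> (real \<Rightarrow> real) \<Rightarrow>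
     real set \<Rightarrow> (real \<Rightarrow> vec) \<Rightarrow> (real \<Rightarrow> vec) \<Rightarrow> bool" where
  "maximal_closed_loop_solution n L vmax vstar \<mu> V b I s v \<longleftrightarrow>
     closed_loop_solution n L vmax vstar \<mu> V b I s v \<and>
     (\<forall>J s' v'. closed_loop_solution n L vmax vstar \<mu> V b J s' v' \<and> I \<subseteq> J \<and>
        (\<forall>t\<in>I. (\<forall>i\<in>{2..n}. s' t i = s t i) \<and> (\<forall>i\<in>{1..n}. v' t i = v t i)) \<longrightarrow> J = I)"

end

theory Submission
  imports Defs
begin

text \<open>\<open>H\<close> is a Lyapunov function with an explicit rate. Write \<open>p\<^sub>i = V'(s\<^sub>i\<^sub>+\<^sub>1) - V'(s\<^sub>i)\<close>. The derivative of the \<open>i\<close>-th kinetic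
  term of \<open>H\<close> in \<open>v\<^sub>i\<close> is \<open>beta * (v\<^sub>i - f\<^sub>i)\<close>, and \<open>Z\<^sub>i\<close> is \<open>vmax\<^sup>2\<close> times the time derivative of \<open>f\<^sub>i\<close>, so the
  feedback cancels everything except the damping and the forces \<open>V'(s\<^sub>i)\<close>. The forces telescope because they
  vanish at both ends of the platoon, and \<open>f\<^sub>i = vstar - b p\<^sub>i\<close> leaves (\<open>H_has_derivative\<close>)

  \<open>H' = - \<mu> vmax\<^sup>2 \<Sum> (v\<^sub>i - f\<^sub>i)\<^sup>2 / (v\<^sub>i (vmax - v\<^sub>i)) - \<Sum> p\<^sub>i b(p\<^sub>i)\<close>.

  First, \<open>H\<close> does not increase, and its sublevel sets keep gaps and speeds away from the boundary of the state
  space (\<open>sublevel_confined\<close>). In bounded time a solution therefore stays in a compact set and can be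
  continued, so maximal solutions are global (\<open>maximal_solution_global\<close>). This uses local existence
  (\<open>picard_lindelof\<close>) and the resulting continuation principle (\<open>ode_solution_continues\<close>).

  Second, the right-hand side is bounded away from zero whenever \<open>H\<close> is
  (\<open>dissipation_lower_bound\<close>): if all \<open>p\<^sub>i\<close> are small, so are all \<open>V'(s\<^sub>i)\<close>, which are sums of them, and then
  no gap can be much below \<open>lam\<close>. An infimal convolution turns these lower bounds into a continuous
  function \<open>\<omega>\<close> with \<open>H' \<le> - \<omega>(H)\<close> (\<open>lower_envelope\<close>), and the flow of \<open>y' = - \<omega>(y)\<close> is the required class KL bound
  (\<open>class_KL_decay\<close>).

  Third, \<open>H\<close> is bounded away from zero at positive distance from the equilibria (\<open>H_lower_bound\<close>). As
  this distance is bounded on the state space, the same convolution gives the class K-infinity lower bound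
  (\<open>class_K_inf_lower_bound\<close>).\<close>

section \<open>Functions Lipschitz near a point\<close>

text \<open>Functions of a state read only the coordinates in a finite index set, so nearness and distance are
  measured on \<open>A\<close> alone. In particular such a function near \<open>x0\<close> cannot depend on the other
  coordinates, see \<open>lipschitz_near_cong\<close>.\<close>
definition lipschitz_near :: "'i set \<Rightarrow> ('i \<Rightarrow> real) \<Rightarrow> (('i \<Rightarrow> real) \<Rightarrow> real) \<Rightarrow> bool" where
  "lipschitz_near A x0 f \<longleftrightarrow>
     (\<exists>r>0. \<exists>K\<ge>0. \<forall>x y. (\<forall>i\<in>A. \<bar>x i - x0 i\<bar> \<le> r) \<longrightarrow> (\<forall>i\<in>A. \<bar>y i - x0 i\<bar> \<le> r) \<longrightarrow>
        \<bar>f x - f y\<bar> \<le> K * (\<Sum>i\<in>A. \<bar>x i - y i\<bar>))"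

lemma lipschitz_nearE:
  assumes "lipschitz_near A x0 f"
  obtains r K where "0 < r" "0 \<le> K"
    "\<And>x y. \<lbrakk>\<And>i. i \<in> A \<Longrightarrow> \<bar>x i - x0 i\<bar> \<le> r; \<And>i. i \<in> A \<Longrightarrow> \<bar>y i - x0 i\<bar> \<le> r\<rbrakk>
       \<Longrightarrow> \<bar>f x - f y\<bar> \<le> K * (\<Sum>i\<in>A. \<bar>x i - y i\<bar>)"
proof -
  from assms obtain r K where rK: "0 < r" "0 \<le> K" and
    L: "\<forall>x y. (\<forall>i\<in>A. \<bar>x i - x0 i\<bar> \<le> r) \<longrightarrow> (\<forall>i\<in>A. \<bar>y i - x0 i\<bar> \<le> r) \<longrightarrow>
        \<bar>f x - f y\<bar> \<le> K * (\<Sum>i\<in>A. \<bar>x i - y i\<bar>)"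
    unfolding lipschitz_near_def by (elim exE conjE)
  show thesis
    by (rule that[OF rK]) (use L in simp)
qed

lemma lipschitz_nearI:
  assumes "0 < r" "0 \<le> K"
    "\<And>x y. \<lbrakk>\<And>i. i \<in> A \<Longrightarrow> \<bar>x i - x0 i\<bar> \<le> r; \<And>i. i \<in> A \<Longrightarrow> \<bar>y i - x0 i\<bar> \<le> r\<rbrakk>
       \<Longrightarrow> \<bar>f x - f y\<bar> \<le> K * (\<Sum>i\<in>A. \<bar>x i - y i\<bar>)"
  shows "lipschitz_near A x0 f"
  unfolding lipschitz_near_def
  by (rule exI[of _ r], rule conjI[OF assms(1)], rule exI[of _ K], rule conjI[OF assms(2)])
     (use assms(3) in simp)

lemma lipschitz_near_const [intro]: "lipschitz_near A x0 (\<lambda>x. c)"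
  by (rule lipschitz_nearI[of 1 0]) auto

lemma lipschitz_near_coordinate [intro]:
  assumes "finite A" "j \<in> A"
  shows "lipschitz_near A x0 (\<lambda>x. x j)"
proof (rule lipschitz_nearI[of 1 1])
  fix x y :: "'a \<Rightarrow> real"
  show "\<bar>x j - y j\<bar> \<le> 1 * (\<Sum>i\<in>A. \<bar>x i - y i\<bar>)"
    using member_le_sum[of j A "\<lambda>i. \<bar>x i - y i\<bar>"] assms by simp
qed auto

lemma lipschitz_near_add:
  assumes "lipschitz_near A x0 f" "lipschitz_near A x0 g"
  shows "lipschitz_near A x0 (\<lambda>x. f x + g x)"
proof -
  obtain r K where f: "0 < r" "0 \<le> K"
    "\<And>x y. \<lbrakk>\<And>i. i \<in> A \<Longrightarrow> \<bar>x i - x0 i\<bar> \<le> r; \<And>i. i \<in> A \<Longrightarrow> \<bar>y i - x0 i\<bar> \<le> r\<rbrakk>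
       \<Longrightarrow> \<bar>f x - f y\<bar> \<le> K * (\<Sum>i\<in>A. \<bar>x i - y i\<bar>)"
    by (rule lipschitz_nearE[OF assms(1)]) blast
  obtain s M where g: "0 < s" "0 \<le> M"
    "\<And>x y. \<lbrakk>\<And>i. i \<in> A \<Longrightarrow> \<bar>x i - x0 i\<bar> \<le> s; \<And>i. i \<in> A \<Longrightarrow> \<bar>y i - x0 i\<bar> \<le> s\<rbrakk>
       \<Longrightarrow> \<bar>g x - g y\<bar> \<le> M * (\<Sum>i\<in>A. \<bar>x i - y i\<bar>)"
    by (rule lipschitz_nearE[OF assms(2)]) blast
  show ?thesis
  proof (rule lipschitz_nearI[of "min r s" "K + M"])
    fix x y assume "\<And>i. i \<in> A \<Longrightarrow> \<bar>x i - x0 i\<bar> \<le> min r s" "\<And>i. i \<in> A \<Longrightarrow> \<bar>y i - x0 i\<bar> \<le> min r s"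
    then have "\<bar>f x - f y\<bar> \<le> K * (\<Sum>i\<in>A. \<bar>x i - y i\<bar>)" "\<bar>g x - g y\<bar> \<le> M * (\<Sum>i\<in>A. \<bar>x i - y i\<bar>)"
      using f(3)[of x y] g(3)[of x y] by auto
    then show "\<bar>f x + g x - (f y + g y)\<bar> \<le> (K + M) * (\<Sum>i\<in>A. \<bar>x i - y i\<bar>)"
      by (simp add: algebra_simps)
  qed (use f g in auto)
qed

text \<open>On a compact neighbourhood of \<open>f x0\<close> the continuous derivative of \<open>g\<close> is bounded, so \<open>g\<close> is
  Lipschitz there; the radius is shrunk so that \<open>f\<close> maps the box into this neighbourhood. All
  arithmetic closure properties below are instances of this lemma, products through the polarization
  identity.\<close>
lemma lipschitz_near_compose:
  fixes g :: "real \<Rightarrow> real"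
  assumes f: "lipschitz_near A x0 f" and "finite A" and "open U" "f x0 \<in> U"
    and der: "\<And>z. z \<in> U \<Longrightarrow> (g has_real_derivative g' z) (at z)"
    and cont: "continuous_on U g'"
  shows "lipschitz_near A x0 (\<lambda>x. g (f x))"
proof -
  obtain r K where rK: "0 < r" "0 \<le> K"
    "\<And>x y. \<lbrakk>\<And>i. i \<in> A \<Longrightarrow> \<bar>x i - x0 i\<bar> \<le> r; \<And>i. i \<in> A \<Longrightarrow> \<bar>y i - x0 i\<bar> \<le> r\<rbrakk>
       \<Longrightarrow> \<bar>f x - f y\<bar> \<le> K * (\<Sum>i\<in>A. \<bar>x i - y i\<bar>)"
    by (rule lipschitz_nearE[OF f]) blast
  obtain e where e: "0 < e" "cball (f x0) e \<subseteq> U"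
    using \<open>open U\<close> \<open>f x0 \<in> U\<close> open_contains_cball by blast
  have "bounded (g' ` cball (f x0) e)"
    by (intro compact_imp_bounded compact_continuous_image continuous_on_subset[OF cont] e) auto
  then obtain B where B: "\<And>z. z \<in> cball (f x0) e \<Longrightarrow> \<bar>g' z\<bar> \<le> B"
    unfolding bounded_iff by (metis imageI real_norm_def)
  have B0: "0 \<le> B" using B[of "f x0"] e by (metis abs_ge_zero centre_in_cball less_imp_le order_trans)
  have gl: "\<bar>g a - g b\<bar> \<le> B * \<bar>a - b\<bar>" if "a \<in> cball (f x0) e" "b \<in> cball (f x0) e" for a b
    using field_differentiable_bound[of "cball (f x0) e" g g' B a b] that B e
      has_field_derivative_at_within[OF der] by (force simp: subset_eq)
  define q where "q = min r (e / (K * card A + 1))"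
  have den: "0 < K * card A + 1" using rK by (simp add: add_nonneg_pos)
  have q: "0 < q" "q \<le> r" unfolding q_def using rK e den by auto
  have stay: "f x \<in> cball (f x0) e" if "\<And>i. i \<in> A \<Longrightarrow> \<bar>x i - x0 i\<bar> \<le> q" for x
  proof -
    have "\<bar>f x - f x0\<bar> \<le> K * (\<Sum>i\<in>A. \<bar>x i - x0 i\<bar>)"
      using that q rK by (intro rK(3)) force+
    also have "\<dots> \<le> K * (card A * q)"
      using rK that by (intro mult_left_mono sum_bounded_above) auto
    also have "\<dots> \<le> (K * card A + 1) * q" using q by (simp add: algebra_simps)
    also have "\<dots> \<le> (K * card A + 1) * (e / (K * card A + 1))"
      unfolding q_def using den by (intro mult_left_mono) auto
    also have "\<dots> = e" using den by simp
    finally show ?thesis by (simp add: dist_real_def)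
  qed
  show ?thesis
  proof (rule lipschitz_nearI[of q "B * K"])
    fix x y assume x: "\<And>i. i \<in> A \<Longrightarrow> \<bar>x i - x0 i\<bar> \<le> q" and y: "\<And>i. i \<in> A \<Longrightarrow> \<bar>y i - x0 i\<bar> \<le> q"
    have "\<bar>g (f x) - g (f y)\<bar> \<le> B * \<bar>f x - f y\<bar>" using stay x y by (intro gl) auto
    also have "\<dots> \<le> B * (K * (\<Sum>i\<in>A. \<bar>x i - y i\<bar>))"
      using x y q B0 by (intro mult_left_mono rK(3)) force+
    finally show "\<bar>g (f x) - g (f y)\<bar> \<le> B * K * (\<Sum>i\<in>A. \<bar>x i - y i\<bar>)" by (simp add: mult.assoc)
  qed (use q B0 rK in auto)
qed

lemma lipschitz_near_cmult:
  assumes "lipschitz_near A x0 f" "finite A"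
  shows "lipschitz_near A x0 (\<lambda>x. c * f x)"
  using lipschitz_near_compose[OF assms, of UNIV "\<lambda>z. c * z" "\<lambda>_. c"]
  by (auto intro!: derivative_eq_intros)

lemma lipschitz_near_diff:
  assumes "lipschitz_near A x0 f" "lipschitz_near A x0 g" "finite A"
  shows "lipschitz_near A x0 (\<lambda>x. f x - g x)"
  using lipschitz_near_add[OF assms(1) lipschitz_near_cmult[OF assms(2,3), of "-1"]] by simp

lemma lipschitz_near_mult:
  assumes "lipschitz_near A x0 f" "lipschitz_near A x0 g" "finite A"
  shows "lipschitz_near A x0 (\<lambda>x. f x * g x)"
proof -
  have sq: "lipschitz_near A x0 (\<lambda>x. (h x)\<^sup>2)" if "lipschitz_near A x0 h" for h
    by (rule lipschitz_near_compose[OF that assms(3), of UNIV "\<lambda>z. z\<^sup>2" "\<lambda>z. 2 * z"])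
      (auto intro!: derivative_eq_intros continuous_intros)
  have "lipschitz_near A x0 (\<lambda>x. (1/4) * ((f x + g x)\<^sup>2 - (f x - g x)\<^sup>2))"
    by (intro lipschitz_near_cmult lipschitz_near_diff sq lipschitz_near_add assms)
  moreover have "(\<lambda>x. (1/4) * ((f x + g x)\<^sup>2 - (f x - g x)\<^sup>2)) = (\<lambda>x. f x * g x)"
    by (auto simp: power2_eq_square algebra_simps)
  ultimately show ?thesis by simp
qed

lemma lipschitz_near_divide:
  assumes "lipschitz_near A x0 f" "lipschitz_near A x0 g" "finite A" "g x0 \<noteq> 0"
  shows "lipschitz_near A x0 (\<lambda>x. f x / g x)"
proof -
  have "lipschitz_near A x0 (\<lambda>x. inverse (g x))"
    by (rule lipschitz_near_compose[OF assms(2,3), of "-{0}" inverse "\<lambda>z. - inverse (z ^ 2)"])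
      (use assms(4) in \<open>auto intro!: derivative_eq_intros continuous_intros simp: power2_eq_square\<close>)
  from lipschitz_near_mult[OF assms(1) this assms(3)] show ?thesis by (simp add: divide_inverse)
qed

lemma lipschitz_near_cong:
  assumes "lipschitz_near A x0 f" "\<And>i. i \<in> A \<Longrightarrow> x i = x0 i" "\<And>i. i \<in> A \<Longrightarrow> y i = x0 i"
  shows "f x = f y"
proof -
  obtain r K where rK: "0 < r" "0 \<le> K"
    "\<And>x y. \<lbrakk>\<And>i. i \<in> A \<Longrightarrow> \<bar>x i - x0 i\<bar> \<le> r; \<And>i. i \<in> A \<Longrightarrow> \<bar>y i - x0 i\<bar> \<le> r\<rbrakk>
       \<Longrightarrow> \<bar>f x - f y\<bar> \<le> K * (\<Sum>i\<in>A. \<bar>x i - y i\<bar>)"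
    by (rule lipschitz_nearE[OF assms(1)]) blast
  have "\<bar>f x - f y\<bar> \<le> K * (\<Sum>i\<in>A. \<bar>x i - y i\<bar>)"
    using assms rK by (intro rK(3)) auto
  also have "(\<Sum>i\<in>A. \<bar>x i - y i\<bar>) = 0" using assms by simp
  finally show ?thesis by simp
qed

lemma lipschitz_near_imp_isCont:
  fixes A :: "nat set"
  assumes "lipschitz_near A x0 f" "finite A"
  shows "isCont f x0"
proof -
  obtain r K where rK: "0 < r" "0 \<le> K"
    "\<And>x y. \<lbrakk>\<And>i. i \<in> A \<Longrightarrow> \<bar>x i - x0 i\<bar> \<le> r; \<And>i. i \<in> A \<Longrightarrow> \<bar>y i - x0 i\<bar> \<le> r\<rbrakk>
       \<Longrightarrow> \<bar>f x - f y\<bar> \<le> K * (\<Sum>i\<in>A. \<bar>x i - y i\<bar>)"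
    by (rule lipschitz_nearE[OF assms(1)]) blast
  have coord: "((\<lambda>x. x i) \<longlongrightarrow> x0 i) (at x0)" for i
  proof -
    have "continuous_on UNIV (\<lambda>x :: nat \<Rightarrow> real. x i)" by (rule continuous_on_product_coordinates)
    then show ?thesis unfolding continuous_on_eq_continuous_at[OF open_UNIV] isCont_def by blast
  qed
  have "\<forall>\<^sub>F x in at x0. \<forall>i\<in>A. \<bar>x i - x0 i\<bar> \<le> r"
  proof (intro eventually_ball_finite[OF assms(2)] ballI)
    fix i
    show "\<forall>\<^sub>F x in at x0. \<bar>x i - x0 i\<bar> \<le> r"
      using tendstoD[OF coord[of i] rK(1)] by eventually_elim (simp add: dist_real_def)
  qed
  then have ev: "\<forall>\<^sub>F x in at x0. norm (f x - f x0) \<le> K * (\<Sum>i\<in>A. \<bar>x i - x0 i\<bar>)"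
    by eventually_elim (use rK in auto)
  have "((\<lambda>x. K * (\<Sum>i\<in>A. \<bar>x i - x0 i\<bar>)) \<longlongrightarrow> K * (\<Sum>i\<in>A. \<bar>x0 i - x0 i\<bar>)) (at x0)"
    by (intro tendsto_intros coord)
  then have "((\<lambda>x. f x - f x0) \<longlongrightarrow> 0) (at x0)"
    by (intro Lim_null_comparison[OF ev]) simp
  then show ?thesis unfolding isCont_def using LIM_zero_iff by blast
qed

section \<open>Local existence and continuation of solutions\<close>

definition solves_ode ::
    "'i set \<Rightarrow> (('i \<Rightarrow> real) \<Rightarrow> 'i \<Rightarrow> real) \<Rightarrow> real set \<Rightarrow> (real \<Rightarrow> 'i \<Rightarrow> real) \<Rightarrow> bool" where
  "solves_ode A G I u \<longleftrightarrow>
     (\<forall>t\<in>I. \<forall>j\<in>A. ((\<lambda>\<tau>. u \<tau> j) has_real_derivative G (u t) j) (at t within I))"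

lemma has_field_derivative_eq_on:
  assumes "x \<in> S" "\<And>y. y \<in> S \<Longrightarrow> g y = f y" "(f has_field_derivative D) (at x within S)"
  shows "(g has_field_derivative D) (at x within S)"
  by (rule has_field_derivative_transform_within[OF assms(3) zero_less_one assms(1)]) (simp add: assms(2))

text \<open>Picard iteration needs a complete space of curves with coordinates indexed by \<open>A\<close>. Coordinate and time
  are merged into one argument: a curve is a bounded continuous function
  on \<open>\<real> \<times> \<real>\<close> whose value at \<open>(t, real i)\<close> is the coordinate \<open>i\<close> at time \<open>t\<close>, interpolated between integers
  by tent functions to keep it continuous. The field is made globally Lipschitz by clamping the state
  to a box and time to \<open>[0, h]\<close>; for small \<open>h\<close> the fixed point stays in the box, where clamping does
  nothing.\<close>
lemma picard_lindelof:
  fixes G :: "(nat \<Rightarrow> real) \<Rightarrow> nat \<Rightarrow> real"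
  assumes fin: "finite A" and lip: "\<And>j. j \<in> A \<Longrightarrow> lipschitz_near A x0 (\<lambda>x. G x j)" and "0 < \<epsilon>"
  obtains h u where "0 < h" "\<And>i. i \<in> A \<Longrightarrow> u 0 i = x0 i"
    "\<And>t i. t \<in> {0..h} \<Longrightarrow> i \<in> A \<Longrightarrow> \<bar>u t i - x0 i\<bar> \<le> \<epsilon>" "solves_ode A G {0..h} u"
proof -
  have "\<forall>j\<in>A. \<exists>rK. 0 < fst rK \<and> 0 \<le> snd rK \<and>
     (\<forall>x y. (\<forall>i\<in>A. \<bar>x i - x0 i\<bar> \<le> fst rK) \<longrightarrow> (\<forall>i\<in>A. \<bar>y i - x0 i\<bar> \<le> fst rK) \<longrightarrow>
        \<bar>G x j - G y j\<bar> \<le> snd rK * (\<Sum>i\<in>A. \<bar>x i - y i\<bar>))" (is "\<forall>j\<in>A. ?Q j")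
  proof
    fix j assume "j \<in> A"
    from lip[OF this] obtain r K where "0 < r" "0 \<le> K"
      "\<forall>x y. (\<forall>i\<in>A. \<bar>x i - x0 i\<bar> \<le> r) \<longrightarrow> (\<forall>i\<in>A. \<bar>y i - x0 i\<bar> \<le> r) \<longrightarrow>
        \<bar>G x j - G y j\<bar> \<le> K * (\<Sum>i\<in>A. \<bar>x i - y i\<bar>)"
      unfolding lipschitz_near_def by (elim exE conjE)
    then show "?Q j" by (intro exI[of _ "(r, K)"]) simp
  qed
  from bchoice[OF this] obtain rK where rK: "\<And>j. j \<in> A \<Longrightarrow> 0 < fst (rK j)" "\<And>j. j \<in> A \<Longrightarrow> 0 \<le> snd (rK j)"
     and rKl: "\<And>j x y. \<lbrakk>j \<in> A; \<forall>i\<in>A. \<bar>x i - x0 i\<bar> \<le> fst (rK j); \<forall>i\<in>A. \<bar>y i - x0 i\<bar> \<le> fst (rK j)\<rbrakk> \<Longrightarrow>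
        \<bar>G x j - G y j\<bar> \<le> snd (rK j) * (\<Sum>i\<in>A. \<bar>x i - y i\<bar>)" by blast
  \<comment> \<open>a common radius and a common Lipschitz constant for all components\<close>
  define R where "R = Min (insert \<epsilon> ((\<lambda>j. fst (rK j)) ` A))"
  define k where "k = (\<Sum>j\<in>A. snd (rK j))"
  have R: "0 < R" "R \<le> \<epsilon>" "\<And>j. j \<in> A \<Longrightarrow> R \<le> fst (rK j)"
    unfolding R_def using fin \<open>0 < \<epsilon>\<close> rK(1) by (auto simp: Min_gr_iff intro!: Min_le)
  have k: "0 \<le> k" "\<And>j. j \<in> A \<Longrightarrow> snd (rK j) \<le> k"
    unfolding k_def using fin rK(2) by (auto intro!: sum_nonneg member_le_sum)
  have lipR: "\<bar>G x j - G y j\<bar> \<le> k * (\<Sum>i\<in>A. \<bar>x i - y i\<bar>)"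
    if "j \<in> A" "\<And>i. i \<in> A \<Longrightarrow> \<bar>x i - x0 i\<bar> \<le> R" "\<And>i. i \<in> A \<Longrightarrow> \<bar>y i - x0 i\<bar> \<le> R" for j x y
  proof -
    have "\<bar>G x j - G y j\<bar> \<le> snd (rK j) * (\<Sum>i\<in>A. \<bar>x i - y i\<bar>)"
      using that R(3)[OF that(1)] by (intro rKl) force+
    also have "\<dots> \<le> k * (\<Sum>i\<in>A. \<bar>x i - y i\<bar>)"
      using k that by (intro mult_right_mono sum_nonneg) auto
    finally show ?thesis .
  qed
  define m where "m = real (card A)"
  define M where "M = (\<Sum>j\<in>A. \<bar>G x0 j\<bar>) + k * (m * R)"
  define c where "c x i = max (x0 i - R) (min (x0 i + R) (x i))" for x :: "nat \<Rightarrow> real" and i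
  have c_box: "\<bar>c x i - x0 i\<bar> \<le> R" for x i unfolding c_def using R by auto
  have c_lip: "\<bar>c x i - c y i\<bar> \<le> \<bar>x i - y i\<bar>" for x y i unfolding c_def by auto
  have c_id: "c x i = x i" if "\<bar>x i - x0 i\<bar> \<le> R" for x i using that unfolding c_def by auto
  have m0: "0 \<le> m" unfolding m_def by simp
  have M0: "0 \<le> M" unfolding M_def using k R m0 by (intro add_nonneg_nonneg sum_nonneg) auto
  have Gc: "\<bar>G (c x) j - G (c y) j\<bar> \<le> k * (\<Sum>i\<in>A. \<bar>x i - y i\<bar>)" if "j \<in> A" for x y j
  proof -
    have "\<bar>G (c x) j - G (c y) j\<bar> \<le> k * (\<Sum>i\<in>A. \<bar>c x i - c y i\<bar>)"
      by (intro lipR that c_box)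
    also have "\<dots> \<le> k * (\<Sum>i\<in>A. \<bar>x i - y i\<bar>)"
      using k by (intro mult_left_mono sum_mono c_lip) auto
    finally show ?thesis .
  qed
  have Gb: "\<bar>G (c x) j\<bar> \<le> M" if "j \<in> A" for x j
  proof -
    have "\<bar>G (c x) j - G x0 j\<bar> \<le> k * (\<Sum>i\<in>A. \<bar>c x i - x0 i\<bar>)"
      using R by (intro lipR that c_box) auto
    also have "\<dots> \<le> k * (m * R)"
      unfolding m_def using k c_box by (intro mult_left_mono sum_bounded_above) auto
    finally have "\<bar>G (c x) j\<bar> \<le> \<bar>G x0 j\<bar> + k * (m * R)" by linarith
    moreover have "\<bar>G x0 j\<bar> \<le> (\<Sum>j\<in>A. \<bar>G x0 j\<bar>)" using fin that by (intro member_le_sum) auto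
    ultimately show ?thesis unfolding M_def by linarith
  qed
  \<comment> \<open>the first bound keeps the solution in the box, the second makes the Picard map halve distances;
    the extra factor \<open>m\<close> pays for the sum over the tents\<close>
  define h where "h = min (R / (M + 1)) (1 / (2 * (m * (k * m) + 1)))"
  have km: "0 \<le> m * (k * m)" using k m0 by simp
  have h0: "0 < h" unfolding h_def using R M0 km by auto
  have "M * h \<le> (M + 1) * h" using h0 by simp
  also have "\<dots> \<le> (M + 1) * (R / (M + 1))" unfolding h_def using M0 by (intro mult_left_mono) auto
  finally have hM: "M * h \<le> R" using M0 by simp
  have "(m * (k * m)) * h \<le> (m * (k * m) + 1) * h" using h0 by simp
  also have "\<dots> \<le> (m * (k * m) + 1) * (1 / (2 * (m * (k * m) + 1)))"
    unfolding h_def using km by (intro mult_left_mono) auto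
  also have "\<dots> = 1 / 2" using km by (simp add: divide_simps)
  finally have hk: "(m * (k * m)) * h \<le> 1 / 2" .
  define cl where "cl t = max 0 (min h t)" for t :: real
  have cl: "cl t \<in> {0..h}" for t unfolding cl_def using h0 by auto
  have cl_id: "cl t = t" if "t \<in> {0..h}" for t using that unfolding cl_def by auto
  define g where "g u i s = G (c (\<lambda>j. apply_bcontfun u (s, real j))) i"
    for u :: "(real \<times> real) \<Rightarrow>\<^sub>C real" and i s
  have g_cont: "continuous_on S (g u i)" if "i \<in> A" for u i S
  proof -
    have "isCont (g u i) t" for t
    proof -
      have co: "isCont (\<lambda>s. apply_bcontfun u (s, real j)) t" for j
      proof -
        have "continuous_on UNIV (\<lambda>s. apply_bcontfun u (s, real j))"
          by (rule continuous_on_compose2[OF continuous_on_apply_bcontfun[of UNIV u]])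
            (auto intro!: continuous_intros)
        then show ?thesis unfolding continuous_on_eq_continuous_at[OF open_UNIV] by blast
      qed
      have "((\<lambda>s. k * (\<Sum>j\<in>A. \<bar>apply_bcontfun u (s, real j) - apply_bcontfun u (t, real j)\<bar>)) \<longlongrightarrow>
          k * (\<Sum>j\<in>A. \<bar>apply_bcontfun u (t, real j) - apply_bcontfun u (t, real j)\<bar>)) (at t)"
        by (intro tendsto_intros co[unfolded isCont_def])
      then have lim0: "((\<lambda>s. k * (\<Sum>j\<in>A. \<bar>apply_bcontfun u (s, real j) - apply_bcontfun u (t, real j)\<bar>)) \<longlongrightarrow> 0) (at t)"
        by simp
      have "norm (g u i s - g u i t) \<le> k * (\<Sum>j\<in>A. \<bar>apply_bcontfun u (s, real j) - apply_bcontfun u (t, real j)\<bar>)" for s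
        unfolding g_def real_norm_def by (rule Gc[OF that])
      then have "((\<lambda>s. g u i s - g u i t) \<longlongrightarrow> 0) (at t)"
        by (intro Lim_null_comparison[OF _ lim0] always_eventually allI)
      then show ?thesis unfolding isCont_def using LIM_zero_iff by blast
    qed
    then show ?thesis by (simp add: continuous_at_imp_continuous_on)
  qed
  define tent where "tent i x = max 0 (1 - \<bar>x - real i\<bar>)" for i x
  have tent: "0 \<le> tent i x" "tent i x \<le> 1" for i x unfolding tent_def by auto
  have tent_nat: "tent i (real j) = (if i = j then 1 else 0)" for i j unfolding tent_def by auto
  define P0 where "P0 u = (\<lambda>(t, x). \<Sum>i\<in>A. tent i x * (x0 i + integral {0..cl t} (g u i)))"
    for u :: "(real \<times> real) \<Rightarrow>\<^sub>C real"
  have int_bound: "\<bar>integral {0..cl t} f\<bar> \<le> B * h"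
    if "continuous_on {0..cl t} f" "\<And>s. \<bar>f s\<bar> \<le> B" for f B t
  proof -
    have "\<bar>integral {0..cl t} f\<bar> \<le> B * (cl t - 0)"
      using integral_bound[of 0 "cl t" f B] that cl[of t] by auto
    also have "\<dots> \<le> B * h"
      using cl[of t] that(2)[of 0] by (intro mult_left_mono) auto
    finally show ?thesis .
  qed
  have int_g: "\<bar>integral {0..cl t} (g u i)\<bar> \<le> M * h" if "i \<in> A" for u t i
    by (intro int_bound g_cont that) (simp add: g_def Gb that)
  have P0: "P0 u \<in> bcontfun" for u
  proof (rule bcontfun_normI)
    have "continuous_on UNIV (\<lambda>p. integral {0..cl (fst p)} (g u i))" if "i \<in> A" for i
    proof (rule continuous_on_compose2[of "{0..h}" "\<lambda>x. integral {0..x} (g u i)"])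
      show "continuous_on {0..h} (\<lambda>x. integral {0..x} (g u i))"
        by (intro indefinite_integral_continuous_1 integrable_continuous_interval g_cont that)
      show "continuous_on UNIV (\<lambda>p. cl (fst p))"
        unfolding cl_def by (intro continuous_intros)
    qed (use cl in auto)
    then show "continuous_on UNIV (P0 u)"
      unfolding P0_def case_prod_unfold tent_def by (intro continuous_intros)
    fix p :: "real \<times> real"
    obtain t x where p: "p = (t, x)" by fastforce
    have "\<bar>tent i x * (x0 i + integral {0..cl t} (g u i))\<bar> \<le> 1 * (\<bar>x0 i\<bar> + M * h)" if "i \<in> A" for i
      unfolding abs_mult using tent[of i x] int_g[OF that, of t u] by (intro mult_mono) auto
    then show "norm (P0 u p) \<le> (\<Sum>i\<in>A. \<bar>x0 i\<bar> + M * h)"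
      unfolding p P0_def prod.case real_norm_def by (intro order_trans[OF sum_abs] sum_mono) simp
  qed
  define P where "P u = Bcontfun (P0 u)" for u
  have P: "apply_bcontfun (P u) = P0 u" for u unfolding P_def using P0 by (simp add: Bcontfun_inverse)
  have contr: "dist (P u) (P w) \<le> 1/2 * dist u w" for u w
  proof (rule dist_bound)
    fix p :: "real \<times> real"
    obtain t x where p: "p = (t, x)" by fastforce
    have "\<bar>tent i x * (integral {0..cl t} (g u i) - integral {0..cl t} (g w i))\<bar> \<le> 1 * ((k * m) * dist u w * h)"
      if i: "i \<in> A" for i
    proof -
      have ii: "g v i integrable_on {0..cl t}" for v
        by (intro integrable_continuous_interval g_cont i)
      have "\<bar>g u i s - g w i s\<bar> \<le> (k * m) * dist u w" for s
      proof -
        have "\<bar>g u i s - g w i s\<bar> \<le> k * (\<Sum>j\<in>A. \<bar>apply_bcontfun u (s, real j) - apply_bcontfun w (s, real j)\<bar>)"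
          unfolding g_def by (rule Gc[OF i])
        also have "\<dots> \<le> k * (m * dist u w)"
          unfolding m_def using k dist_bounded[of u _ w]
          by (intro mult_left_mono sum_bounded_above) (auto simp: dist_real_def)
        finally show ?thesis by simp
      qed
      then have "\<bar>integral {0..cl t} (\<lambda>s. g u i s - g w i s)\<bar> \<le> (k * m) * dist u w * h"
        by (intro int_bound continuous_intros g_cont i)
      then show ?thesis
        unfolding abs_mult using tent[of i x] ii
        by (intro mult_mono) (auto simp: Henstock_Kurzweil_Integration.integral_diff)
    qed
    then have "\<bar>\<Sum>i\<in>A. tent i x * (integral {0..cl t} (g u i) - integral {0..cl t} (g w i))\<bar>
        \<le> (\<Sum>i\<in>A. 1 * ((k * m) * dist u w * h))"
      by (intro order_trans[OF sum_abs] sum_mono) auto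
    also have "\<dots> = (m * (k * m)) * h * dist u w" by (simp add: m_def)
    also have "\<dots> \<le> 1/2 * dist u w" using hk by (intro mult_right_mono) auto
    finally show "dist (apply_bcontfun (P u) p) (apply_bcontfun (P w) p) \<le> 1/2 * dist u w"
      by (simp add: P p P0_def dist_real_def sum_subtractf[symmetric] algebra_simps)
  qed
  obtain u where u: "P u = u"
    using banach_fix_type[of "1/2" P] contr by auto
  define U where "U t i = apply_bcontfun u (t, real i)" for t i
  have U: "U t i = x0 i + integral {0..t} (g u i)" if "t \<in> {0..h}" "i \<in> A" for t i
  proof -
    have "U t i = (\<Sum>j\<in>A. (if j = i then 1 else 0) * (x0 j + integral {0..cl t} (g u j)))"
      unfolding U_def using P[of u] unfolding u by (simp add: P0_def tent_nat)
    also have "\<dots> = (\<Sum>j\<in>A. if j = i then x0 j + integral {0..cl t} (g u j) else 0)"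
      by (intro sum.cong) auto
    finally show ?thesis using fin that cl_id[OF that(1)] by simp
  qed
  have Ubox: "\<bar>U t i - x0 i\<bar> \<le> R" if "t \<in> {0..h}" "i \<in> A" for t i
  proof -
    have "\<bar>integral {0..cl t} (g u i)\<bar> \<le> M * h" by (rule int_g[OF that(2)])
    then show ?thesis using U[OF that] hM cl_id[OF that(1)] by simp
  qed
  have gG: "g u i t = G (U t) i" if "t \<in> {0..h}" "i \<in> A" for t i
  proof -
    have "\<bar>G (c (U t)) i - G (U t) i\<bar> \<le> k * (\<Sum>j\<in>A. \<bar>c (U t) j - U t j\<bar>)"
      by (intro lipR that c_box Ubox)
    also have "(\<Sum>j\<in>A. \<bar>c (U t) j - U t j\<bar>) = 0" using c_id Ubox that by (intro sum.neutral) auto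
    finally show ?thesis unfolding g_def U_def by simp
  qed
  have "solves_ode A G {0..h} U"
    unfolding solves_ode_def
  proof (intro ballI)
    fix t i assume t: "t \<in> {0..h}" "i \<in> A"
    have "((\<lambda>x. x0 i + integral {0..x} (g u i)) has_real_derivative g u i t) (at t within {0..h})"
      using integral_has_real_derivative[OF g_cont[OF t(2)] t(1)] by (auto intro!: derivative_eq_intros)
    then show "((\<lambda>\<tau>. U \<tau> i) has_real_derivative G (U t) i) (at t within {0..h})"
      using has_field_derivative_eq_on[OF t(1), of "\<lambda>\<tau>. U \<tau> i"] U t gG by auto
  qed
  then show thesis
    using that[of h U] h0 U[of 0] Ubox R(2) by force
qed

text \<open>One-sided derivatives at a junction point combine. If \<open>x\<close> lies outside one of the closed sets,
  the filter of that set at \<open>x\<close> is trivial and its half of the claim is void.\<close>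
lemma has_real_derivative_within_Un:
  fixes f :: "real \<Rightarrow> real"
  assumes "closed S" "closed T"
    and "x \<in> S \<Longrightarrow> (f has_real_derivative D) (at x within S)"
    and "x \<in> T \<Longrightarrow> (f has_real_derivative D) (at x within T)"
  shows "(f has_real_derivative D) (at x within S \<union> T)"
proof -
  have *: "((\<lambda>y. (f y - f x) / (y - x)) \<longlongrightarrow> D) (at x within R)"
    if "closed R" "x \<in> R \<Longrightarrow> (f has_real_derivative D) (at x within R)" for R
  proof (cases "x \<in> R")
    case False
    then have "at x within R = bot"
      using that(1) by (simp add: at_within_eq_bot_iff)
    then show ?thesis by simp
  qed (use that in \<open>simp add: has_field_derivative_iff\<close>)
  show ?thesis
    unfolding has_field_derivative_iff
    unfolding at_within_union
    by (intro filterlim_sup * assms)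
qed

text \<open>The local solution through the end state, shifted in time, is glued on. Its coordinates outside \<open>A\<close> are
  unrelated to those of \<open>u\<close>, hence the assumption that the field reads only the coordinates in \<open>A\<close>.\<close>
lemma ode_continue_closed:
  fixes A :: "nat set"
  assumes fin: "finite A" and "0 \<le> T"
    and lip: "\<And>j. j \<in> A \<Longrightarrow> lipschitz_near A (u T) (\<lambda>x. G x j)"
    and opn: "\<And>i. i \<in> A \<Longrightarrow> open (U i)" and uU: "\<And>t i. t \<in> {0..T} \<Longrightarrow> i \<in> A \<Longrightarrow> u t i \<in> U i"
    and sol: "solves_ode A G {0..T} u"
    and depends: "\<And>x y j. j \<in> A \<Longrightarrow> (\<And>i. i \<in> A \<Longrightarrow> x i \<in> U i) \<Longrightarrow> (\<And>i. i \<in> A \<Longrightarrow> x i = y i) \<Longrightarrow> G x j = G y j"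
  obtains h w where "0 < h" "\<And>t i. t \<in> {0..T} \<Longrightarrow> i \<in> A \<Longrightarrow> w t i = u t i"
    "\<And>t i. t \<in> {0..T + h} \<Longrightarrow> i \<in> A \<Longrightarrow> w t i \<in> U i" "solves_ode A G {0..T + h} w"
proof -
  have "\<forall>i\<in>A. \<exists>e>0. cball (u T i) e \<subseteq> U i"
    using opn uU[of T] \<open>0 \<le> T\<close> by (auto simp: open_contains_cball)
  from bchoice[OF this] obtain e where e: "\<And>i. i \<in> A \<Longrightarrow> 0 < e i" "\<And>i. i \<in> A \<Longrightarrow> cball (u T i) (e i) \<subseteq> U i"
    by blast
  define \<epsilon> where "\<epsilon> = Min (insert 1 (e ` A))"
  have \<epsilon>: "0 < \<epsilon>" "\<And>i. i \<in> A \<Longrightarrow> \<epsilon> \<le> e i"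
    unfolding \<epsilon>_def using fin e(1) by (auto simp: Min_gr_iff intro!: Min_le)
  obtain h z where h: "0 < h" and z0: "\<And>i. i \<in> A \<Longrightarrow> z 0 i = u T i"
    and zb: "\<And>t i. t \<in> {0..h} \<Longrightarrow> i \<in> A \<Longrightarrow> \<bar>z t i - u T i\<bar> \<le> \<epsilon>" and zs: "solves_ode A G {0..h} z"
    using picard_lindelof[where G = G and ?x0.0 = "u T" and A = A and \<epsilon> = \<epsilon>] fin lip \<epsilon>(1) by blast
  define w where "w t = (if t \<le> T then u t else z (t - T))" for t
  have w1: "w t i = u t i" if "t \<in> {0..T}" for t i using that by (simp add: w_def)
  have w2: "w t i = z (t - T) i" if "t \<in> {T..T + h}" "i \<in> A" for t i
    using that z0 by (cases "t = T") (auto simp: w_def)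
  have zU: "z t i \<in> U i" if "t \<in> {0..h}" "i \<in> A" for t i
  proof -
    have "z t i \<in> cball (u T i) (e i)"
      using zb[OF that] \<epsilon>(2)[OF that(2)] by (auto simp: dist_real_def)
    then show ?thesis using e(2)[OF that(2)] by blast
  qed
  have wU: "w t i \<in> U i" if "t \<in> {0..T + h}" "i \<in> A" for t i
    using that w1[of t i] w2[of t i] uU[of t i] zU[of "t - T" i] by (cases "t \<le> T") auto
  have "solves_ode A G ({0..T} \<union> {T..T + h}) w"
    unfolding solves_ode_def
  proof (intro ballI has_real_derivative_within_Un)
    fix t j assume j: "j \<in> A"
    {
      assume t: "t \<in> {0..T}"
      have "((\<lambda>\<tau>. u \<tau> j) has_real_derivative G (u t) j) (at t within {0..T})"
        using sol t j by (auto simp: solves_ode_def)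
      moreover have "G (w t) j = G (u t) j" using t by (simp add: w_def)
      ultimately show "((\<lambda>\<tau>. w \<tau> j) has_real_derivative G (w t) j) (at t within {0..T})"
        using has_field_derivative_eq_on[OF t, of "\<lambda>\<tau>. w \<tau> j"] w1 by auto
    }
    {
      assume t: "t \<in> {T..T + h}"
      have im: "(\<lambda>\<tau>. \<tau> - T) ` {T..T + h} = {0..h}"
        using image_add_atLeastAtMost'[of "-T" T "T + h"] by simp
      have "((\<lambda>\<tau>. z \<tau> j) has_real_derivative G (z (t - T)) j) (at (t - T) within {0..h})"
        using zs t j by (auto simp: solves_ode_def)
      then have "((\<lambda>\<tau>. z \<tau> j) \<circ> (\<lambda>\<tau>. \<tau> - T) has_real_derivative G (z (t - T)) j * 1) (at t within {T..T + h})"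
        by (intro DERIV_image_chain) (auto simp: im intro!: derivative_eq_intros)
      moreover have "G (w t) j = G (z (t - T)) j"
        using w2[OF t] wU[of t] t j \<open>0 \<le> T\<close> by (intro depends) auto
      ultimately show "((\<lambda>\<tau>. w \<tau> j) has_real_derivative G (w t) j) (at t within {T..T + h})"
        using has_field_derivative_eq_on[OF t, of "\<lambda>\<tau>. w \<tau> j"] w2 j by (auto simp: comp_def)
    }
  qed auto
  moreover have "{0..T} \<union> {T..T + h} = {0..T + h}" using \<open>0 \<le> T\<close> h by auto
  ultimately show thesis using that[of h w] h w1 wU by simp
qed

text \<open>On a compact box the field is bounded, so the solution is Lipschitz in time and extends
  continuously to the missing endpoint. There the differential equation holds because the extension
  is the integral of a continuous function.\<close>
lemma ode_continue_half_open:
  fixes A :: "nat set"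
  assumes fin: "finite A" and "0 < T"
    and lip: "\<And>x j. (\<And>i. i \<in> A \<Longrightarrow> x i \<in> C i) \<Longrightarrow> j \<in> A \<Longrightarrow> lipschitz_near A x (\<lambda>x. G x j)"
    and C: "\<And>i. i \<in> A \<Longrightarrow> compact (C i)"
    and uC: "\<And>t i. t \<in> {0..<T} \<Longrightarrow> i \<in> A \<Longrightarrow> u t i \<in> C i"
    and sol: "solves_ode A G {0..<T} u"
  obtains w where "\<And>t i. t \<in> {0..<T} \<Longrightarrow> i \<in> A \<Longrightarrow> w t i = u t i"
    "\<And>t i. t \<in> {0..T} \<Longrightarrow> i \<in> A \<Longrightarrow> w t i \<in> C i" "solves_ode A G {0..T} w"
proof -
  have GC: "isCont (\<lambda>x. G x j) x" if "\<And>i. i \<in> A \<Longrightarrow> x i \<in> C i" "j \<in> A" for x j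
    by (intro lipschitz_near_imp_isCont[OF lip fin] that)
  \<comment> \<open>setting the coordinates outside \<open>A\<close> to zero makes the box compact in the product topology\<close>
  define K where "K = PiE UNIV (\<lambda>i. if i \<in> A then C i else {0})"
  have "compactin (product_topology (\<lambda>i. euclidean) UNIV) K"
    unfolding K_def compactin_PiE using C by auto
  then have K: "compact K" by (simp add: euclidean_product_topology)
  have "\<exists>B. \<forall>x\<in>K. \<bar>G x j\<bar> \<le> B" if "j \<in> A" for j
  proof -
    have "continuous_on K (\<lambda>x. G x j)"
      by (intro continuous_at_imp_continuous_on ballI GC that) (auto simp: K_def PiE_iff split: if_splits)
    then have "bounded ((\<lambda>x. G x j) ` K)" by (intro compact_imp_bounded compact_continuous_image K)
    then show ?thesis unfolding bounded_iff by auto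
  qed
  then obtain B where B: "\<And>j x. j \<in> A \<Longrightarrow> x \<in> K \<Longrightarrow> \<bar>G x j\<bar> \<le> B j" by metis
  have Gb: "\<bar>G (u t) j\<bar> \<le> \<bar>B j\<bar>" if "t \<in> {0..<T}" "j \<in> A" for t j
  proof -
    let ?x = "\<lambda>i. if i \<in> A then u t i else 0"
    have "G (u t) j = G ?x j"
      by (rule lipschitz_near_cong[OF lip[of "u t" j]]) (use that uC in auto)
    moreover have "?x \<in> K" unfolding K_def using that uC by auto
    ultimately show ?thesis using B[OF that(2)] by force
  qed
  have "\<forall>j\<in>A. \<exists>g. continuous_on {0..T} g \<and> (\<forall>t\<in>{0..<T}. u t j = g t)"
  proof
    fix j assume j: "j \<in> A"
    have "\<bar>B j\<bar>-lipschitz_on {0..<T} (\<lambda>t. u t j)"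
    proof (rule lipschitz_onI)
      fix x y assume xy: "x \<in> {0..<T}" "y \<in> {0..<T}"
      have "norm (u x j - u y j) \<le> \<bar>B j\<bar> * norm (x - y)"
        by (rule field_differentiable_bound[of "{0..<T}" _ "\<lambda>t. G (u t) j"])
          (use sol j Gb xy in \<open>auto simp: solves_ode_def\<close>)
      then show "dist (u x j) (u y j) \<le> \<bar>B j\<bar> * dist x y" by (simp add: dist_real_def)
    qed auto
    then have "uniformly_continuous_on {0..<T} (\<lambda>t. u t j)" by (rule lipschitz_on_uniformly_continuous)
    then obtain g where "uniformly_continuous_on (closure {0..<T}) g" "\<And>t. t \<in> {0..<T} \<Longrightarrow> u t j = g t"
      by (rule uniformly_continuous_on_extension_on_closure) blast
    then show "\<exists>g. continuous_on {0..T} g \<and> (\<forall>t\<in>{0..<T}. u t j = g t)"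
      using \<open>0 < T\<close> by (auto dest: uniformly_continuous_imp_continuous)
  qed
  from bchoice[OF this] obtain g where g: "\<And>j. j \<in> A \<Longrightarrow> continuous_on {0..T} (g j)"
    "\<And>j t. j \<in> A \<Longrightarrow> t \<in> {0..<T} \<Longrightarrow> u t j = g j t" by blast
  define w where "w t i = (if i \<in> A then g i t else 0)" for t i
  have w_cont: "continuous_on {0..T} (\<lambda>t. w t i)" for i
    unfolding w_def using g(1)[of i] by (cases "i \<in> A") auto
  have w_eq: "w t i = u t i" if "t \<in> {0..<T}" "i \<in> A" for t i using g(2) that by (simp add: w_def)
  have wC: "w t i \<in> C i" if "t \<in> {0..T}" "i \<in> A" for t i
  proof -
    have "(\<lambda>t. w t i) ` closure {0..<T} \<subseteq> C i"
      using \<open>0 < T\<close> w_cont[of i] uC w_eq that by (intro image_closure_subset compact_imp_closed C) auto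
    then show ?thesis using that \<open>0 < T\<close> by auto
  qed
  have "solves_ode A G {0..T} w"
    unfolding solves_ode_def
  proof (intro ballI)
    fix t j assume t: "t \<in> {0..T}" and j: "j \<in> A"
    have qc: "continuous_on {0..T} (\<lambda>t. G (w t) j)"
      unfolding continuous_on_eq_continuous_within
    proof
      fix t assume t: "t \<in> {0..T}"
      have "continuous_on {0..T} w" by (intro continuous_on_coordinatewise_then_product w_cont)
      then have "continuous (at t within {0..T}) w" using t continuous_on_eq_continuous_within by blast
      moreover have "isCont (\<lambda>x. G x j) (w t)" by (rule GC) (use wC t j in auto)
      ultimately show "continuous (at t within {0..T}) (\<lambda>t. G (w t) j)"
        by (rule continuous_within_compose3[rotated])
    qed
    define q where "q = (\<lambda>t. G (w t) j)"
    have Iq: "((\<lambda>t. integral {0..t} q) has_real_derivative q s) (at s within {0..T})" if "s \<in> {0..T}" for s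
      using integral_has_real_derivative[OF qc that] by (simp add: q_def)
    have w_int: "w s j = w 0 j + integral {0..s} q" if "s \<in> {0..T}" for s
    proof -
      define p where "p s = w s j - integral {0..s} q" for s
      have "continuous_on {0..T} (\<lambda>t. integral {0..t} q)"
        using qc unfolding q_def
        by (intro indefinite_integral_continuous_1 integrable_continuous_interval)
      then have "continuous_on {0..T} p" unfolding p_def by (intro continuous_on_diff w_cont)
      moreover have "(p has_real_derivative 0) (at x)" if x: "0 < x" "x < T" for x
      proof -
        have "((\<lambda>t. u t j) has_real_derivative G (u x) j) (at x within {0..<T})"
          using sol x j by (auto simp: solves_ode_def)
        then have "((\<lambda>t. w t j) has_real_derivative G (u x) j) (at x within {0..<T})"
          using has_field_derivative_eq_on[of x "{0..<T}" "\<lambda>t. w t j"] w_eq x j by auto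
        moreover have "at x within {0..<T} = at x" using x by (intro at_within_interior) auto
        moreover have "G (u x) j = G (w x) j"
          by (rule lipschitz_near_cong[OF lip[of "u x" j]]) (use x j uC w_eq in auto)
        ultimately have "((\<lambda>t. w t j) has_real_derivative q x) (at x)" by (simp add: q_def)
        moreover have "((\<lambda>t. integral {0..t} q) has_real_derivative q x) (at x)"
          using Iq[of x] x by (simp add: at_within_Icc_at)
        ultimately show ?thesis unfolding p_def by (auto intro!: derivative_eq_intros)
      qed
      ultimately have "p s = p 0" using DERIV_isconst2[OF \<open>0 < T\<close>, of p s] that by auto
      then show ?thesis by (simp add: p_def)
    qed
    show "((\<lambda>\<tau>. w \<tau> j) has_real_derivative G (w t) j) (at t within {0..T})"
    proof (rule has_field_derivative_eq_on[OF t w_int])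
      have "((\<lambda>s. w 0 j + integral {0..s} q) has_real_derivative 0 + q t) (at t within {0..T})"
        by (intro DERIV_add DERIV_const Iq t)
      then show "((\<lambda>s. w 0 j + integral {0..s} q) has_real_derivative G (w t) j) (at t within {0..T})"
        by (simp add: q_def)
    qed
  qed
  then show thesis using that[of w] w_eq wC by blast
qed

text \<open>The usual escape alternative: a solution on a bounded time interval whose coordinates stay in compact
  subsets of the domain is not maximal.\<close>
lemma ode_solution_continues:
  fixes A :: "nat set"
  assumes fin: "finite A"
    and opn: "\<And>i. i \<in> A \<Longrightarrow> open (U i)"
    and lip: "\<And>x j. (\<And>i. i \<in> A \<Longrightarrow> x i \<in> U i) \<Longrightarrow> j \<in> A \<Longrightarrow> lipschitz_near A x (\<lambda>x. G x j)"
    and I: "is_interval I" "0 \<in> I" "I \<subseteq> {0..}" "bdd_above I"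
    and C: "\<And>i. i \<in> A \<Longrightarrow> compact (C i)" "\<And>i. i \<in> A \<Longrightarrow> C i \<subseteq> U i"
    and uC: "\<And>t i. t \<in> I \<Longrightarrow> i \<in> A \<Longrightarrow> u t i \<in> C i"
    and sol: "solves_ode A G I u"
  obtains J w where "is_interval J" "I \<subset> J" "J \<subseteq> {0..}"
    "\<And>t i. t \<in> I \<Longrightarrow> i \<in> A \<Longrightarrow> w t i = u t i"
    "\<And>t i. t \<in> J \<Longrightarrow> i \<in> A \<Longrightarrow> w t i \<in> U i" "solves_ode A G J w"
proof -
  define T where "T = Sup I"
  have le: "t \<le> T" if "t \<in> I" for t unfolding T_def using cSup_upper[OF that I(4)] .
  have T0: "0 \<le> T" using le[OF I(2)] .
  have mem: "t \<in> I" if t: "0 \<le> t" "t < T" for t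
  proof -
    obtain s where "s \<in> I" "t < s" using t(2) less_cSup_iff[of I t] I unfolding T_def by blast
    then show ?thesis using I(1,2) t(1) unfolding is_interval_1 by (meson less_imp_le)
  qed
  show thesis
  proof (cases "T \<in> I")
    case True
    have eq: "I = {0..T}"
    proof (intro equalityI subsetI)
      fix t assume "t \<in> {0..T}"
      then show "t \<in> I" using mem[of t] True by (cases "t = T") auto
    qed (use le I(3) in auto)
    obtain h w where "0 < h" "\<And>t i. t \<in> {0..T} \<Longrightarrow> i \<in> A \<Longrightarrow> w t i = u t i"
      "\<And>t i. t \<in> {0..T + h} \<Longrightarrow> i \<in> A \<Longrightarrow> w t i \<in> U i" "solves_ode A G {0..T + h} w"
    proof (rule ode_continue_closed[OF fin T0, of u G U])
      show "G x j = G y j" if "j \<in> A" "\<And>i. i \<in> A \<Longrightarrow> x i \<in> U i" "\<And>i. i \<in> A \<Longrightarrow> x i = y i" for x y j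
        by (rule lipschitz_near_cong[OF lip[OF that(2,1)]]) (simp_all add: that(3))
      show "lipschitz_near A (u T) (\<lambda>x. G x j)" if "j \<in> A" for j
        by (rule lip) (use C(2) uC[OF True] that in auto)
      show "open (U i)" if "i \<in> A" for i using opn that .
      show "u t i \<in> U i" if "t \<in> {0..T}" "i \<in> A" for t i using uC C(2) that eq by blast
      show "solves_ode A G {0..T} u" using sol eq by simp
    qed (rule that)
    then show thesis using T0 by (intro that[of "{0..T + h}" w]) (auto simp: eq)
  next
    case False
    have eq: "I = {0..<T}"
    proof (intro equalityI subsetI)
      fix t assume "t \<in> I"
      moreover from this False have "t \<noteq> T" by blast
      ultimately show "t \<in> {0..<T}" using le[of t] I(3) by auto
    qed (use mem in auto)
    then have "0 < T" using I(2) by auto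
    obtain w where w: "\<And>t i. t \<in> {0..<T} \<Longrightarrow> i \<in> A \<Longrightarrow> w t i = u t i"
      "\<And>t i. t \<in> {0..T} \<Longrightarrow> i \<in> A \<Longrightarrow> w t i \<in> C i" "solves_ode A G {0..T} w"
    proof (rule ode_continue_half_open[OF fin \<open>0 < T\<close>, of C G u])
      show "lipschitz_near A x (\<lambda>x. G x j)" if "\<And>i. i \<in> A \<Longrightarrow> x i \<in> C i" "j \<in> A" for x j
      proof (rule lip)
        show "x i \<in> U i" if "i \<in> A" for i
          using C(2)[OF \<open>i \<in> A\<close>] \<open>\<And>i. i \<in> A \<Longrightarrow> x i \<in> C i\<close>[OF \<open>i \<in> A\<close>] by (rule subsetD)
      qed (rule that(2))
      show "compact (C i)" if "i \<in> A" for i using C(1) that .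
      show "u t i \<in> C i" if "t \<in> {0..<T}" "i \<in> A" for t i using uC that eq by simp
      show "solves_ode A G {0..<T} u" using sol eq by simp
    qed (rule that)
    show thesis
    proof (rule that[of "{0..T}" w])
      show "w t i \<in> U i" if "t \<in> {0..T}" "i \<in> A" for t i using w(2)[OF that] C(2)[OF that(2)] by blast
      show "I \<subset> {0..T}" using T0 by (auto simp: eq)
    qed (use w eq in \<open>auto\<close>)
  qed
qed

section \<open>Comparison functions\<close>

text \<open>Wherever \<open>p\<close> is at least \<open>\<delta>\<close>, \<open>q\<close> is bounded below by a positive constant depending on \<open>\<delta>\<close>, in no regular
  way. The infimal convolution \<open>r \<mapsto> inf\<^sub>x q x + max 0 (r - p x)\<close> turns these constants into one
  monotone 1-Lipschitz function of \<open>r\<close>. It is positive at \<open>r > 0\<close> because either \<open>p x \<ge> r/2\<close>, which bounds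
  \<open>q x\<close> below, or the penalty is at least \<open>r/2\<close>. The last conclusion gives unboundedness when \<open>p\<close> is
  bounded.\<close>
lemma lower_envelope:
  fixes p q :: "'a \<Rightarrow> real"
  assumes "X \<noteq> {}" and q0: "\<And>x. x \<in> X \<Longrightarrow> 0 \<le> q x"
    and pos: "\<And>\<delta>. 0 < \<delta> \<Longrightarrow> \<exists>c>0. \<forall>x\<in>X. \<delta> \<le> p x \<longrightarrow> c \<le> q x"
  obtains \<alpha> where "continuous_on UNIV \<alpha>" "mono \<alpha>" "\<And>r. 0 < r \<Longrightarrow> 0 < \<alpha> r"
    "\<And>x. x \<in> X \<Longrightarrow> \<alpha> (p x) \<le> q x" "\<And>r D. (\<And>x. x \<in> X \<Longrightarrow> p x \<le> D) \<Longrightarrow> r - D \<le> \<alpha> r"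
proof -
  define \<alpha> where "\<alpha> r = (INF x\<in>X. q x + max 0 (r - p x))" for r
  have bdd: "bdd_below ((\<lambda>x. q x + max 0 (r - p x)) ` X)" for r
    by (rule bdd_belowI[of _ 0]) (use q0 in \<open>auto intro!: add_nonneg_nonneg\<close>)
  have up: "\<alpha> r \<le> q x + max 0 (r - p x)" if "x \<in> X" for r x
    unfolding \<alpha>_def by (rule cINF_lower[OF bdd that])
  have lo: "b \<le> \<alpha> r" if "\<And>x. x \<in> X \<Longrightarrow> b \<le> q x + max 0 (r - p x)" for r b
    unfolding \<alpha>_def by (rule cINF_greatest[OF assms(1) that])
  have mono: "\<alpha> r \<le> \<alpha> r'" if "r \<le> r'" for r r'
    by (rule lo) (use up[of _ r] that in force)
  have grow: "\<alpha> r' \<le> \<alpha> r + (r' - r)" if "r \<le> r'" for r r'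
  proof -
    have "\<alpha> r' - (r' - r) \<le> \<alpha> r"
      by (rule lo) (use up[of _ r'] that in force)
    then show ?thesis by linarith
  qed
  have "1-lipschitz_on UNIV \<alpha>"
  proof (rule lipschitz_onI)
    fix r r' :: real
    show "dist (\<alpha> r) (\<alpha> r') \<le> 1 * dist r r'"
      using mono[of r r'] mono[of r' r] grow[of r r'] grow[of r' r] by (cases "r \<le> r'") (auto simp: dist_real_def)
  qed auto
  then have "continuous_on UNIV \<alpha>" by (rule lipschitz_on_continuous_on)
  moreover have "mono \<alpha>" using mono by (rule monoI)
  moreover have "0 < \<alpha> r" if "0 < r" for r
  proof -
    obtain c where c: "0 < c" "\<And>x. x \<in> X \<Longrightarrow> r / 2 \<le> p x \<Longrightarrow> c \<le> q x"
      using pos[of "r / 2"] \<open>0 < r\<close> by auto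
    have "min c (r / 2) \<le> \<alpha> r"
    proof (rule lo)
      fix x assume "x \<in> X"
      then show "min c (r / 2) \<le> q x + max 0 (r - p x)"
        using c(2)[of x] q0[of x] by (cases "r / 2 \<le> p x") auto
    qed
    then show ?thesis using c(1) \<open>0 < r\<close> by auto
  qed
  moreover have "\<alpha> (p x) \<le> q x" if "x \<in> X" for x using up[OF that, of "p x"] by simp
  moreover have "r - D \<le> \<alpha> r" if "\<And>x. x \<in> X \<Longrightarrow> p x \<le> D" for r D
    by (rule lo) (use that q0 in force)
  ultimately show thesis by (rule that)
qed

lemma class_K_inf_lower_bound:
  fixes d H :: "'a \<Rightarrow> real"
  assumes "X \<noteq> {}" and "\<And>x. x \<in> X \<Longrightarrow> 0 \<le> H x" and d0: "\<And>x. x \<in> X \<Longrightarrow> 0 \<le> d x" and dD: "\<And>x. x \<in> X \<Longrightarrow> d x \<le> D"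
    and "\<And>\<delta>. 0 < \<delta> \<Longrightarrow> \<exists>c>0. \<forall>x\<in>X. \<delta> \<le> d x \<longrightarrow> c \<le> H x"
  obtains a where "class_K_inf a" "\<And>x. x \<in> X \<Longrightarrow> a (d x) \<le> H x"
proof -
  obtain \<alpha> where \<alpha>: "continuous_on UNIV \<alpha>" "mono \<alpha>" "\<And>r. 0 < r \<Longrightarrow> 0 < \<alpha> r"
    "\<And>x. x \<in> X \<Longrightarrow> \<alpha> (d x) \<le> H x" and grow: "\<And>r D. (\<And>x. x \<in> X \<Longrightarrow> d x \<le> D) \<Longrightarrow> r - D \<le> \<alpha> r"
    using lower_envelope[of X H d] assms by metis
  \<comment> \<open>the factor makes the envelope strictly increasing and zero at the origin, and is at most one\<close>
  define a where "a r = \<alpha> r * (r / (1 + r))" for r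
  have "strict_mono_on {0..} a"
  proof (rule strict_mono_onI)
    fix r s :: real assume rs: "r \<in> {0..}" "s \<in> {0..}" "r < s"
    have "a r \<le> \<alpha> s * (r / (1 + r))"
      unfolding a_def using rs monoD[OF \<alpha>(2), of r s] by (intro mult_right_mono) auto
    also have "\<dots> < \<alpha> s * (s / (1 + s))"
      using rs \<alpha>(3)[of s] by (intro mult_strict_left_mono) (auto simp: divide_simps algebra_simps)
    finally show "a r < a s" unfolding a_def .
  qed
  moreover have "continuous_on {0..} a"
    unfolding a_def by (intro continuous_intros continuous_on_subset[OF \<alpha>(1)]) auto
  moreover have "0 \<le> a r" if "0 \<le> r" for r
    using that \<alpha>(3)[of r] by (cases "r = 0") (auto simp: a_def)
  ultimately have "class_K a" unfolding class_K_def by (auto simp: a_def)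
  moreover have "filterlim a at_top at_top"
  proof (rule filterlim_at_top_mono)
    show "filterlim (\<lambda>r. (1 / 2) * (- D + r)) at_top at_top"
      by (intro filterlim_tendsto_pos_mult_at_top[OF tendsto_const]
            filterlim_tendsto_add_at_top[OF tendsto_const] filterlim_ident) auto
    show "\<forall>\<^sub>F r in at_top. (1 / 2) * (- D + r) \<le> a r"
      using eventually_ge_at_top[of "max 1 D"]
    proof eventually_elim
      case (elim r)
      have "(- D + r) * (1 / 2) \<le> \<alpha> r * (r / (1 + r))"
        using elim grow[of D r] dD by (intro mult_mono) (auto simp: divide_simps)
      then show ?case by (simp add: a_def)
    qed
  qed
  ultimately have "class_K_inf a" unfolding class_K_inf_def by blast
  moreover have "a (d x) \<le> H x" if "x \<in> X" for x
  proof -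
    have "a (d x) \<le> H x * 1"
      unfolding a_def using d0[OF that] assms(2)[OF that] \<alpha>(4)[OF that]
      by (intro mult_mono) (auto simp: divide_simps)
    then show ?thesis by simp
  qed
  ultimately show thesis by (rule that)
qed

text \<open>The flow of the scalar equation \<open>y' = - \<omega>(y)\<close> is a class KL bound for all its subsolutions. In the variable
  \<open>u = ln y\<close> let \<open>G\<close> be a primitive of \<open>exp u / \<omega> (exp u)\<close>; a subsolution then decreases \<open>G u\<close> at speed at
  least one, which suggests \<open>\<sigma> r t = exp (J (G (ln r) - t))\<close> with \<open>J\<close> the inverse of \<open>G\<close>. Since \<open>\<omega> r \<le> r\<close>, the
  slope of \<open>G\<close> is at least one. Hence \<open>G\<close> is onto the reals, so that \<open>\<sigma>\<close> is defined for all times,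
  and \<open>J\<close> is 1-Lipschitz, so that \<open>\<sigma>\<close> is continuous.\<close>
lemma class_KL_decay:
  fixes \<omega> :: "real \<Rightarrow> real"
  assumes cont: "continuous_on {0<..} \<omega>" and \<omega>: "\<And>r. 0 < r \<Longrightarrow> 0 < \<omega> r" "\<And>r. 0 < r \<Longrightarrow> \<omega> r \<le> r"
  obtains \<sigma> where "class_KL \<sigma>"
    "\<And>y y' t. \<lbrakk>0 \<le> t; continuous_on {0..t} y; \<And>\<tau>. 0 \<le> \<tau> \<Longrightarrow> \<tau> \<le> t \<Longrightarrow> 0 \<le> y \<tau>;
       \<And>\<tau>. 0 < \<tau> \<Longrightarrow> \<tau> < t \<Longrightarrow> (y has_real_derivative y' \<tau>) (at \<tau>);
       \<And>\<tau>. 0 < \<tau> \<Longrightarrow> \<tau> < t \<Longrightarrow> y' \<tau> \<le> 0;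
       \<And>\<tau>. 0 < \<tau> \<Longrightarrow> \<tau> < t \<Longrightarrow> 0 < y \<tau> \<Longrightarrow> y' \<tau> \<le> - \<omega> (y \<tau>)\<rbrakk> \<Longrightarrow> y t \<le> \<sigma> (y 0) t"
proof -
  define \<phi> where "\<phi> u = exp u / \<omega> (exp u)" for u
  have \<phi>1: "1 \<le> \<phi> u" for u unfolding \<phi>_def using \<omega>[of "exp u"] by (simp add: le_divide_eq)
  have "continuous_on UNIV (\<lambda>u. \<omega> (exp u))"
    by (rule continuous_on_compose2[OF cont]) (auto intro!: continuous_intros)
  then have "continuous_on UNIV \<phi>"
    unfolding \<phi>_def using \<omega>(1)[of "exp _"] by (intro continuous_intros) (auto simp: less_imp_neq[symmetric])
  then have "isCont \<phi> u" for u using continuous_on_eq_continuous_at[OF open_UNIV] by blast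
  then obtain G where "\<And>u. (G has_vector_derivative \<phi> u) (at u)"
    using einterval_antiderivative[of "-\<infinity>" "\<infinity>" \<phi>] by auto
  then have G: "(G has_real_derivative \<phi> u) (at u)" for u
    by (simp add: has_real_derivative_iff_has_vector_derivative)
  have G_cont: "continuous_on S G" for S
    using G DERIV_isCont by (intro continuous_at_imp_continuous_on) blast
  have G_grow: "w - u \<le> G w - G u" if "u \<le> w" for u w
  proof -
    have "G u - u \<le> G w - w"
    proof (rule DERIV_nonneg_imp_nondecreasing[OF that])
      fix x
      have "((\<lambda>x. G x - x) has_real_derivative \<phi> x - 1) (at x)"
        by (intro DERIV_diff G DERIV_ident)
      then show "\<exists>y. ((\<lambda>x. G x - x) has_real_derivative y) (at x) \<and> 0 \<le> y" using \<phi>1[of x] by force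
    qed
    then show ?thesis by linarith
  qed
  have G_less: "G u < G w \<longleftrightarrow> u < w" for u w
    using G_grow[of u w] G_grow[of w u] by linarith
  have "\<exists>u. G u = y" for y
  proof -
    define c where "c = \<bar>y - G 0\<bar>"
    have "G (-c) \<le> y" "y \<le> G c" using G_grow[of "-c" 0] G_grow[of 0 c] unfolding c_def by auto
    then show ?thesis using IVT'[of G "-c" y c] G_cont by (auto simp: c_def)
  qed
  then obtain J where J: "\<And>y. G (J y) = y" by metis
  have JG: "J (G u) = u" for u using G_less[of u "J (G u)"] G_less[of "J (G u)" u] J[of "G u"] by force
  have J_less: "J a < J b \<longleftrightarrow> a < b" for a b using G_less[of "J a" "J b"] J by simp
  have J_le: "J a \<le> J b \<longleftrightarrow> a \<le> b" for a b using J_less[of b a] by auto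
  have "1-lipschitz_on UNIV J"
  proof (rule lipschitz_onI)
    fix a b :: real
    show "dist (J a) (J b) \<le> 1 * dist a b"
      using G_grow[of "J a" "J b"] G_grow[of "J b" "J a"] J by (cases "J a \<le> J b") (auto simp: dist_real_def)
  qed auto
  then have J_cont: "continuous_on UNIV J" by (rule lipschitz_on_continuous_on)
  define \<sigma> where "\<sigma> r t = (if r \<le> 0 then 0 else exp (J (G (ln r) - t)))" for r t :: real
  have \<sigma>_nonneg: "0 \<le> \<sigma> r t" for r t unfolding \<sigma>_def by simp
  have \<sigma>_le: "\<sigma> r t \<le> r" if "0 \<le> r" "0 \<le> t" for r t
  proof (cases "r = 0")
    case False
    then have "J (G (ln r) - t) \<le> J (G (ln r))" using that by (simp add: J_le)
    then have "exp (J (G (ln r) - t)) \<le> exp (ln r)" by (simp add: JG)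
    then show ?thesis using False that by (simp add: \<sigma>_def)
  qed (simp add: \<sigma>_def)
  have \<sigma>_cont: "continuous_on ({0..} \<times> {0..}) (\<lambda>(r, t). \<sigma> r t)"
    unfolding continuous_on_def
  proof
    fix p :: "real \<times> real" assume p: "p \<in> {0..} \<times> {0..}"
    let ?F = "at p within {0..} \<times> {0..}"
    show "((\<lambda>(r, t). \<sigma> r t) \<longlongrightarrow> (case p of (r, t) \<Rightarrow> \<sigma> r t)) ?F"
    proof (cases "0 < fst p")
      case True
      have "isCont (\<lambda>x. exp (J (G (ln (fst x)) - snd x))) p"
      proof (rule continuous_on_interior)
        show "continuous_on ({0<..} \<times> UNIV) (\<lambda>x. exp (J (G (ln (fst x)) - snd x)))"
          by (intro continuous_on_compose2[OF J_cont] continuous_on_compose2[OF G_cont[of UNIV]] continuous_intros) auto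
        show "p \<in> interior ({0<..} \<times> UNIV)"
          using True by (cases p) (simp add: interior_open open_Times)
      qed
      then have "((\<lambda>x. exp (J (G (ln (fst x)) - snd x))) \<longlongrightarrow> exp (J (G (ln (fst p)) - snd p))) ?F"
        unfolding isCont_def by (rule tendsto_within_subset[OF _ subset_UNIV])
      moreover have "\<forall>\<^sub>F x in ?F. exp (J (G (ln (fst x)) - snd x)) = (case x of (r, t) \<Rightarrow> \<sigma> r t)"
      proof -
        have "(fst \<longlongrightarrow> fst p) ?F" by (intro tendsto_fst tendsto_ident_at)
        then have "\<forall>\<^sub>F x in ?F. 0 < fst x" using True by (rule order_tendstoD)
        then show ?thesis by eventually_elim (auto simp: \<sigma>_def)
      qed
      ultimately show ?thesis
        using True by (cases p) (auto simp: \<sigma>_def elim!: Lim_transform_eventually)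
    next
      case False
      then have p0: "fst p = 0" using p by auto
      have "((\<lambda>(r, t). \<sigma> r t) \<longlongrightarrow> 0) ?F"
      proof (rule Lim_null_comparison)
        show "\<forall>\<^sub>F x in ?F. norm (case x of (r, t) \<Rightarrow> \<sigma> r t) \<le> fst x"
          unfolding eventually_at_filter using \<sigma>_nonneg \<sigma>_le by (auto intro!: always_eventually)
        have "(fst \<longlongrightarrow> fst p) ?F" by (intro tendsto_fst tendsto_ident_at)
        then show "(fst \<longlongrightarrow> 0) ?F" by (simp add: p0)
      qed
      then show ?thesis using p0 by (cases p) (simp add: \<sigma>_def)
    qed
  qed
  have "class_KL \<sigma>"
    unfolding class_KL_def
  proof (intro conjI allI impI)
    fix t :: real assume t: "0 \<le> t"
    have "continuous_on {0..} ((\<lambda>(r, t). \<sigma> r t) \<circ> (\<lambda>r. (r, t)))"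
      by (intro continuous_on_compose continuous_on_subset[OF \<sigma>_cont] continuous_intros) (use t in auto)
    moreover have "strict_mono_on {0..} (\<lambda>r. \<sigma> r t)"
      by (rule strict_mono_onI) (auto simp: \<sigma>_def J_less G_less)
    ultimately show "class_K (\<lambda>r. \<sigma> r t)"
      using \<sigma>_nonneg by (auto simp: class_K_def comp_def \<sigma>_def)
  next
    fix r :: real
    show "antimono_on {0..} (\<sigma> r)"
      by (rule monotone_onI) (auto simp: \<sigma>_def J_le)
    show "(\<sigma> r \<longlongrightarrow> 0) at_top"
    proof (cases "r \<le> 0")
      case False
      have "filterlim (\<lambda>t. J (G (ln r) - t)) at_bot at_top"
        unfolding filterlim_at_bot
      proof
        fix B
        have "J (G (ln r) - t) \<le> B" if "G (ln r) - G B \<le> t" for t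
          using J_le[of "G (ln r) - t" "G B"] that by (simp add: JG)
        then show "\<forall>\<^sub>F t in at_top. J (G (ln r) - t) \<le> B"
          by (rule eventually_mono[OF eventually_ge_at_top[of "G (ln r) - G B"]])
      qed
      then have "((\<lambda>t. exp (J (G (ln r) - t))) \<longlongrightarrow> 0) at_top"
        by (rule filterlim_compose[OF exp_at_bot])
      then show ?thesis using False by (simp add: \<sigma>_def[abs_def])
    qed (simp add: \<sigma>_def[abs_def])
  qed (rule \<sigma>_cont)
  moreover have "y t \<le> \<sigma> (y 0) t"
    if t: "0 \<le> t" and yc: "continuous_on {0..t} y" and y0: "\<And>\<tau>. 0 \<le> \<tau> \<Longrightarrow> \<tau> \<le> t \<Longrightarrow> 0 \<le> y \<tau>"
      and yd: "\<And>\<tau>. 0 < \<tau> \<Longrightarrow> \<tau> < t \<Longrightarrow> (y has_real_derivative y' \<tau>) (at \<tau>)"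
      and y'0: "\<And>\<tau>. 0 < \<tau> \<Longrightarrow> \<tau> < t \<Longrightarrow> y' \<tau> \<le> 0"
      and y'\<omega>: "\<And>\<tau>. 0 < \<tau> \<Longrightarrow> \<tau> < t \<Longrightarrow> 0 < y \<tau> \<Longrightarrow> y' \<tau> \<le> - \<omega> (y \<tau>)"
    for y y' t
  proof (cases "y t = 0")
    case True
    then show ?thesis using \<sigma>_nonneg by simp
  next
    case False
    \<comment> \<open>\<open>y\<close> is nonincreasing, so it cannot have vanished before \<open>t\<close> and the logarithm is legitimate\<close>
    have pos: "0 < y \<tau>" if "0 \<le> \<tau>" "\<tau> \<le> t" for \<tau>
    proof -
      have "y t \<le> y \<tau>"
      proof (rule DERIV_nonpos_imp_decreasing_open[OF that(2)])
        show "continuous_on {\<tau>..t} y" by (rule continuous_on_subset[OF yc]) (use that in auto)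
        show "\<exists>d. (y has_real_derivative d) (at x) \<and> d \<le> 0" if "\<tau> < x" "x < t" for x
          using yd[of x] y'0[of x] that \<open>0 \<le> \<tau>\<close> by force
      qed
      then show ?thesis using False y0[of t] t by linarith
    qed
    define z where "z \<tau> = G (ln (y \<tau>)) + \<tau>" for \<tau>
    have "z t \<le> z 0"
    proof (rule DERIV_nonpos_imp_decreasing_open[OF t])
      show "continuous_on {0..t} z"
        unfolding z_def
        by (intro continuous_on_compose2[OF G_cont[of UNIV]] continuous_intros yc) (use pos in force)+
      fix \<tau> assume \<tau>: "0 < \<tau>" "\<tau> < t"
      then have p: "0 < y \<tau>" using pos[of \<tau>] by simp
      have "((\<lambda>\<tau>. G (ln (y \<tau>))) has_real_derivative \<phi> (ln (y \<tau>)) * (1 / y \<tau> * y' \<tau>)) (at \<tau>)"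
        by (intro DERIV_chain2[OF G] DERIV_chain2[OF DERIV_ln_divide] yd \<tau> p)
      then have "(z has_real_derivative \<phi> (ln (y \<tau>)) * (1 / y \<tau> * y' \<tau>) + 1) (at \<tau>)"
        unfolding z_def by (intro DERIV_add DERIV_ident)
      moreover have "\<phi> (ln (y \<tau>)) * (1 / y \<tau> * y' \<tau>) = y' \<tau> / \<omega> (y \<tau>)"
        using p by (simp add: \<phi>_def)
      ultimately have "(z has_real_derivative y' \<tau> / \<omega> (y \<tau>) + 1) (at \<tau>)" by simp
      moreover have "y' \<tau> / \<omega> (y \<tau>) + 1 \<le> 0"
        using y'\<omega>[OF \<tau> p] \<omega>(1)[OF p] by (simp add: field_simps)
      ultimately show "\<exists>d. (z has_real_derivative d) (at \<tau>) \<and> d \<le> 0" by blast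
    qed
    then have "G (ln (y t)) \<le> G (ln (y 0)) - t" by (simp add: z_def)
    then have "ln (y t) \<le> J (G (ln (y 0)) - t)" using J_le[of "G (ln (y t))"] by (simp add: JG)
    then have "exp (ln (y t)) \<le> exp (J (G (ln (y 0)) - t))" by simp
    then show ?thesis using pos[of t] pos[of 0] t by (simp add: \<sigma>_def)
  qed
  ultimately show thesis by (rule that)
qed

section \<open>The platoon and its energy\<close>

text \<open>A bounded kinetic term keeps the speed \<open>u\<close> away from \<open>0\<close> when its target \<open>w\<close> is at least \<open>g\<close>: if \<open>u < g/2\<close>, the
  numerator is at least \<open>g\<^sup>2/4\<close>, which forces the denominator, hence \<open>u\<close>, to be large. Applied to
  \<open>m - u\<close> it gives the distance from the maximal speed.\<close>
lemma boundary_layer: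
  fixes u w g h m :: real
  assumes "0 < u" "u < m" "0 \<le> h" "0 < g" "g \<le> w" and *: "(u - w)\<^sup>2 * m\<^sup>2 \<le> 2 * h * (u * (m - u))"
  shows "min (g / 2) (g\<^sup>2 * m / (8 * (h + 1))) \<le> u"
proof (cases "g / 2 \<le> u")
  case False
  have m: "0 < m" using assms by simp
  have "(g / 2)\<^sup>2 \<le> (w - u)\<^sup>2" using False assms by (intro power_mono) auto
  then have "g\<^sup>2 / 4 * m\<^sup>2 \<le> (u - w)\<^sup>2 * m\<^sup>2"
    by (intro mult_right_mono) (auto simp: power2_commute power_divide)
  also have "\<dots> \<le> 2 * h * (u * m)"
    using * mult_left_mono[of "u * (m - u)" "u * m" "2 * h"] assms by auto
  also have "\<dots> \<le> 2 * (h + 1) * (u * m)" using assms m by (intro mult_right_mono) auto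
  finally have "(g\<^sup>2 / 4 * m) * m \<le> (2 * (h + 1) * u) * m" by (simp add: power2_eq_square mult_ac)
  then have "g\<^sup>2 / 4 * m \<le> 2 * (h + 1) * u" by (rule mult_right_le_imp_le[OF _ m])
  then have "g\<^sup>2 * m / (8 * (h + 1)) \<le> u" using assms by (simp add: divide_simps mult_ac)
  then show ?thesis by simp
qed simp

locale open_road =
  fixes n :: nat and L lam vmax vstar \<mu> :: real and V b :: "real \<Rightarrow> real"
  assumes n: "2 \<le> n" and L_lam: "L < lam"
    and vmax: "0 < vmax" and vstar: "0 < vstar" "vstar < vmax" and \<mu>: "0 < \<mu>"
    and V_C3: "C_k_on 3 V {L<..}"
    and V_nonneg: "\<And>x. L < x \<Longrightarrow> 0 \<le> V x"
    and V_blowup: "filterlim V at_top (at_right L)"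
    and V_zero: "\<And>x. lam \<le> x \<Longrightarrow> V x = 0"
    and dV_neg: "\<And>x. L < x \<Longrightarrow> x < lam \<Longrightarrow> deriv V x < 0"
    and ddV_pos: "\<And>x. L < x \<Longrightarrow> x < lam \<Longrightarrow> 0 < deriv (deriv V) x"
    and b_C2: "C_k_on 2 b UNIV"
    and b_range: "\<And>x. vstar - vmax < b x" "\<And>x. b x < vstar"
    and b_mono: "strict_mono b" and b0: "b 0 = 0"
    and b_sign: "\<And>x. x \<noteq> 0 \<Longrightarrow> 0 < x * b x"
begin

lemma V_derivs:
  assumes "L < x"
  shows "(V has_real_derivative deriv V x) (at x)"
    and "(deriv V has_real_derivative deriv (deriv V) x) (at x)"
    and "(deriv (deriv V) has_real_derivative deriv (deriv (deriv V)) x) (at x)"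
proof -
  have "(deriv ^^ j) V field_differentiable at x" if "j < 3" for j
    using V_C3 assms that unfolding C_k_on_def by auto
  from this[of 0] this[of 1] this[of 2]
  show "(V has_real_derivative deriv V x) (at x)"
    "(deriv V has_real_derivative deriv (deriv V) x) (at x)"
    "(deriv (deriv V) has_real_derivative deriv (deriv (deriv V)) x) (at x)"
    by (simp_all add: field_differentiable_derivI numeral_2_eq_2)
qed

lemma b_derivs:
  "(b has_real_derivative deriv b x) (at x)"
  "(deriv b has_real_derivative deriv (deriv b) x) (at x)"
proof -
  have "(deriv ^^ j) b field_differentiable at x" if "j < 2" for j
    using b_C2 that unfolding C_k_on_def by auto
  from this[of 0] this[of 1]
  show "(b has_real_derivative deriv b x) (at x)"
    "(deriv b has_real_derivative deriv (deriv b) x) (at x)"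
    by (simp_all add: field_differentiable_derivI)
qed

lemma dddV_continuous: "continuous_on {L<..} (deriv (deriv (deriv V)))"
  using V_C3 unfolding C_k_on_def by (simp add: numeral_3_eq_3)

lemma ddb_continuous: "continuous_on UNIV (deriv (deriv b))"
  using b_C2 unfolding C_k_on_def by (simp add: numeral_2_eq_2)

text \<open>At \<open>lam\<close> itself a difference quotient from the left is needed as well; but every point of \<open>[lam, \<infinity>)\<close> is
  a minimum of the nonnegative function \<open>V\<close>.\<close>
lemma deriv_V_zero:
  assumes "lam \<le> x"
  shows "deriv V x = 0"
proof (rule DERIV_local_min[OF V_derivs(1)])
  show "L < x" using assms L_lam by simp
  show "0 < lam - L" using L_lam by simp
  show "\<forall>y. \<bar>x - y\<bar> < lam - L \<longrightarrow> V x \<le> V y"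
    using assms V_zero[of x] by (auto intro!: V_nonneg)
qed

lemma deriv_V_nonpos: "L < x \<Longrightarrow> deriv V x \<le> 0"
  using dV_neg[of x] deriv_V_zero[of x] by (cases "x < lam") auto

lemma deriv_V_mono:
  assumes "L < x" "x \<le> y"
  shows "deriv V x \<le> deriv V y"
proof (cases "y \<le> lam")
  case True
  show ?thesis
  proof (rule DERIV_nonneg_imp_increasing_open[OF assms(2)])
    show "\<exists>d. (deriv V has_real_derivative d) (at z) \<and> 0 \<le> d" if "x < z" "z < y" for z
      using V_derivs(2)[of z] ddV_pos[of z] that assms True by (intro exI[of _ "deriv (deriv V) z"]) simp
    show "continuous_on {x..y} (deriv V)"
      by (intro DERIV_continuous_on[OF has_field_derivative_at_within[OF V_derivs(2)]]) (use assms in auto)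
  qed
next
  case False
  then show ?thesis using deriv_V_nonpos[of x] deriv_V_zero[of y] assms by simp
qed

lemma V_antimono:
  assumes "L < x" "x \<le> y"
  shows "V y \<le> V x"
proof (rule DERIV_nonpos_imp_nonincreasing[OF assms(2)])
  show "\<exists>d. (V has_real_derivative d) (at z) \<and> d \<le> 0" if "x \<le> z" for z
    using V_derivs(1)[of z] deriv_V_nonpos[of z] that assms(1) by (intro exI[of _ "deriv V z"]) simp
qed

lemma V_pos:
  assumes "L < x" "x < lam"
  shows "0 < V x"
proof -
  have "V lam < V x"
  proof (rule DERIV_neg_imp_decreasing_open[OF assms(2)])
    show "\<exists>d. (V has_real_derivative d) (at z) \<and> d < 0" if "x < z" "z < lam" for z
      using V_derivs(1)[of z] dV_neg[of z] that assms by (intro exI[of _ "deriv V z"]) simp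
    show "continuous_on {x..lam} V"
      by (intro DERIV_continuous_on[OF has_field_derivative_at_within[OF V_derivs(1)]]) (use assms in auto)
  qed
  then show ?thesis by (simp add: V_zero)
qed

lemma small_left_of_lam:
  fixes g :: "real \<Rightarrow> real"
  assumes "isCont g lam" "g lam = 0" "0 < \<epsilon>"
  obtains x where "L < x" "x < lam" "\<bar>g x\<bar> < \<epsilon>"
proof -
  have "(g \<longlongrightarrow> 0) (at_left lam)"
    using assms(1) unfolding isCont_def assms(2)
    by (rule tendsto_within_subset) simp
  then have "\<forall>\<^sub>F x in at_left lam. \<bar>g x\<bar> < \<epsilon>"
    using tendstoD[OF _ assms(3)] by (fastforce simp: dist_real_def)
  moreover have "\<forall>\<^sub>F x in at_left lam. L < x \<and> x < lam"
    using eventually_at_left_real[OF L_lam] by (auto elim: eventually_mono)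
  ultimately have "\<forall>\<^sub>F x in at_left lam. L < x \<and> x < lam \<and> \<bar>g x\<bar> < \<epsilon>"
    by eventually_elim auto
  then obtain x where "L < x \<and> x < lam \<and> \<bar>g x\<bar> < \<epsilon>"
    using eventually_happens trivial_limit_at_left_real by blast
  then show thesis using that by blast
qed

lemma b_le_iff: "b x \<le> b y \<longleftrightarrow> x \<le> y"
  using b_mono by (simp add: strict_mono_less_eq)

lemma mult_b_nonneg: "0 \<le> x * b x"
  using b_sign[of x] by (cases "x = 0") auto

abbreviation \<Omega> :: "(vec \<times> vec) set" where "\<Omega> \<equiv> state_space n L vmax"
abbreviation p :: "vec \<Rightarrow> nat \<Rightarrow> real" where "p s i \<equiv> dV n V s (i + 1) - dV n V s i"
abbreviation f :: "vec \<Rightarrow> nat \<Rightarrow> real" where "f \<equiv> f_fun n vstar V b"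
abbreviation F :: "vec \<Rightarrow> vec \<Rightarrow> nat \<Rightarrow> real" where "F \<equiv> F_fun n vmax vstar \<mu> V b"
abbreviation H :: "vec \<Rightarrow> vec \<Rightarrow> real" where "H \<equiv> H_fun n vmax vstar V b"

definition kinetic :: "vec \<Rightarrow> vec \<Rightarrow> real" where
  "kinetic s v = (\<Sum>i=1..n. (v i - f s i)\<^sup>2 / (v i * (vmax - v i)))"

text \<open>The rate at which \<open>H\<close> decreases along solutions, see \<open>H_has_derivative\<close>. It is nonnegative because
  \<open>b\<close> has the sign of its argument.\<close>
definition dissipation :: "vec \<Rightarrow> vec \<Rightarrow> real" where
  "dissipation s v = \<mu> * vmax\<^sup>2 * kinetic s v + (\<Sum>i=1..n. p s i * b (p s i))"

lemma H_eq: "H s v = vmax\<^sup>2 / 2 * kinetic s v + (\<Sum>i=2..n. V (s i))"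
  by (simp add: H_fun_def kinetic_def)

lemma f_bounds: "0 < f s i" "f s i < vmax"
  using b_range[of "p s i"] by (auto simp: f_fun_def)

lemma beta_pos:
  assumes "0 < w" "w < vmax" "0 < y" "y < vmax"
  shows "0 < beta vmax w y"
proof -
  have "0 < vmax\<^sup>2 * (w * (vmax - y) + y * (vmax - w))"
    using assms vmax by (intro mult_pos_pos add_pos_pos) auto
  also have "\<dots> = vmax ^ 3 * (w + y) - 2 * vmax\<^sup>2 * y * w"
    by (simp add: power2_eq_square power3_eq_cube algebra_simps)
  finally show ?thesis unfolding beta_def using assms by (intro divide_pos_pos) auto
qed

lemma kinetic_term_nonneg:
  assumes "(s, v) \<in> \<Omega>" "i \<in> {1..n}"
  shows "0 \<le> (v i - f s i)\<^sup>2 / (v i * (vmax - v i))"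
proof -
  have "0 < v i" "v i < vmax" using assms by (auto simp: state_space_def)
  then show ?thesis by simp
qed

lemma kinetic_nonneg: "(s, v) \<in> \<Omega> \<Longrightarrow> 0 \<le> kinetic s v"
  unfolding kinetic_def by (intro sum_nonneg kinetic_term_nonneg)

lemma V_state_nonneg: "(s, v) \<in> \<Omega> \<Longrightarrow> i \<in> {2..n} \<Longrightarrow> 0 \<le> V (s i)"
  by (auto simp: state_space_def intro!: V_nonneg)

lemma H_nonneg: "(s, v) \<in> \<Omega> \<Longrightarrow> 0 \<le> H s v"
  unfolding H_eq by (intro add_nonneg_nonneg mult_nonneg_nonneg kinetic_nonneg sum_nonneg V_state_nonneg) auto

lemma V_le_H:
  assumes "(s, v) \<in> \<Omega>" "i \<in> {2..n}"
  shows "V (s i) \<le> H s v"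
proof -
  have "V (s i) \<le> (\<Sum>i=2..n. V (s i))"
    using assms V_state_nonneg[OF assms(1)] by (intro member_le_sum) auto
  then show ?thesis
    unfolding H_eq using kinetic_nonneg[OF assms(1)] zero_le_power2[of vmax]
    by (smt (verit) divide_nonneg_nonneg mult_nonneg_nonneg)
qed

lemma kinetic_term_le_H:
  assumes "(s, v) \<in> \<Omega>" "i \<in> {1..n}"
  shows "vmax\<^sup>2 / 2 * ((v i - f s i)\<^sup>2 / (v i * (vmax - v i))) \<le> H s v"
proof -
  have "(v i - f s i)\<^sup>2 / (v i * (vmax - v i)) \<le> kinetic s v"
    unfolding kinetic_def using assms kinetic_term_nonneg[OF assms(1)] by (intro member_le_sum) auto
  then have "vmax\<^sup>2 / 2 * ((v i - f s i)\<^sup>2 / (v i * (vmax - v i))) \<le> vmax\<^sup>2 / 2 * kinetic s v"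
    by (intro mult_left_mono) auto
  moreover have "0 \<le> (\<Sum>i=2..n. V (s i))" by (intro sum_nonneg V_state_nonneg[OF assms(1)])
  ultimately show ?thesis unfolding H_eq by linarith
qed

lemma dV_state_nonpos: "(s, v) \<in> \<Omega> \<Longrightarrow> dV n V s i \<le> 0"
  by (auto simp: dV_def state_space_def intro!: deriv_V_nonpos)

lemma dV_boundary: "dV n V s 1 = 0" "dV n V s (n + 1) = 0" "dV n V s (Suc n) = 0"
  by (auto simp: dV_def)

lemma dissipation_nonneg: "(s, v) \<in> \<Omega> \<Longrightarrow> 0 \<le> dissipation s v"
  unfolding dissipation_def
  by (intro add_nonneg_nonneg mult_nonneg_nonneg kinetic_nonneg sum_nonneg mult_b_nonneg) (use \<mu> in auto)

section \<open>The dissipation identity\<close>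

text \<open>The terms with the desired speed and the transport terms form a telescoping sum whose ends vanish by
  the convention \<open>V'(s\<^sub>1) = V'(s\<^sub>n\<^sub>+\<^sub>1) = 0\<close>.\<close>
lemma power_balance:
  "(\<Sum>i=1..n. (v i - f s i) * (dV n V s i - dV n V s (i + 1))) + (\<Sum>i=2..n. deriv V (s i) * (v (i - 1) - v i))
     = - (\<Sum>i=1..n. p s i * b (p s i))"
proof -
  define g where "g i = (vstar - v (i - 1)) * dV n V s i" for i
  have "(\<Sum>i=2..n. deriv V (s i) * (v (i - 1) - v i)) = (\<Sum>i=2..n. dV n V s i * (v (i - 1) - v i))"
    by (intro sum.cong) (auto simp: dV_def)
  also have "\<dots> = (\<Sum>i=1..n. dV n V s i * (v (i - 1) - v i))"
    by (rule sum.mono_neutral_left) (auto simp: dV_def)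
  finally have shift: "(\<Sum>i=2..n. deriv V (s i) * (v (i - 1) - v i)) = \<dots>" .
  have "(\<Sum>i=1..n. (v i - f s i) * (dV n V s i - dV n V s (i + 1)))
        + (\<Sum>i=2..n. deriv V (s i) * (v (i - 1) - v i)) + (\<Sum>i=1..n. p s i * b (p s i))
      = (\<Sum>i=1..n. g (Suc i) - g i)"
    unfolding shift sum.distrib[symmetric] f_fun_def g_def
    by (intro sum.cong) (auto simp: algebra_simps)
  also have "\<dots> = g (Suc n) - g 1" by (rule sum_Suc_diff) simp
  also have "\<dots> = 0" unfolding g_def dV_boundary by simp
  finally show ?thesis by linarith
qed

text \<open>The quotient rule for one kinetic term, where \<open>F'\<close> and \<open>y'\<close> stand for the derivatives of the speed \<open>v\<close> and of
  its target \<open>y\<close>. This is the origin of \<open>beta\<close>: the derivative of the term in \<open>v\<close> is \<open>beta vmax v y * (v - y)\<close>,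
  so that the factor \<open>1 / beta\<close> in the control law cancels.\<close>
lemma kinetic_term_deriv:
  fixes v y F' y' :: real
  assumes "v \<noteq> 0" "vmax - v \<noteq> 0"
  shows "vmax\<^sup>2 / 2 * ((2 * (v - y) * (F' - y') * (v * (vmax - v)) - (v - y)\<^sup>2 * (F' * (vmax - v) - v * F')) /
       ((v * (vmax - v)) * (v * (vmax - v))))
     = beta vmax v y * F' * (v - y) - vmax\<^sup>2 * (v - y) * y' / (v * (vmax - v))"
proof -
  define w where "w = vmax - v"
  have vm: "vmax = v + w" by (simp add: w_def)
  have "w \<noteq> 0" using assms by (simp add: w_def)
  show ?thesis
    unfolding beta_def w_def[symmetric] using assms(1) \<open>w \<noteq> 0\<close>
    apply (simp add: divide_simps)
    unfolding vm by algebra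
qed

text \<open>By construction \<open>Z_fun\<close> is \<open>vmax\<^sup>2\<close> times the derivative of the target speed. So the \<open>Z\<close>-terms cancel and
  the remaining interaction terms are summed by \<open>power_balance\<close>.\<close>
lemma H_has_derivative:
  assumes state: "(s t, v t) \<in> \<Omega>"
    and s': "\<And>i. i \<in> {2..n} \<Longrightarrow> ((\<lambda>\<tau>. s \<tau> i) has_real_derivative v t (i - 1) - v t i) (at t within I)"
    and v': "\<And>i. i \<in> {1..n} \<Longrightarrow> ((\<lambda>\<tau>. v \<tau> i) has_real_derivative F (s t) (v t) i) (at t within I)"
  shows "((\<lambda>\<tau>. H (s \<tau>) (v \<tau>)) has_real_derivative - dissipation (s t) (v t)) (at t within I)"
proof -
  have sL: "L < s t i" if "i \<in> {2..n}" for i using state that by (auto simp: state_space_def)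
  have v0: "0 < v t i" "v t i < vmax" if "i \<in> {1..n}" for i using state that by (auto simp: state_space_def)
  have dV': "((\<lambda>\<tau>. dV n V (s \<tau>) i) has_real_derivative ddV n V (s t) i * (v t (i - 1) - v t i)) (at t within I)" for i
    unfolding dV_def ddV_def
    using DERIV_chain2[OF V_derivs(2)[OF sL] s'] by (cases "i \<in> {2..n}") auto
  define Z where "Z i = Z_fun n vmax V b (s t) (v t) i" for i
  define e where "e i = v t i - f (s t) i" for i
  define y where "y i = v t i * (vmax - v t i)" for i
  have f': "((\<lambda>\<tau>. f (s \<tau>) i) has_real_derivative Z i / vmax\<^sup>2) (at t within I)" for i
  proof -
    have "((\<lambda>\<tau>. f (s \<tau>) i) has_real_derivative
        0 - deriv b (p (s t) i) * (ddV n V (s t) (i + 1) * (v t (i + 1 - 1) - v t (i + 1)) - ddV n V (s t) i * (v t (i - 1) - v t i)))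
        (at t within I)"
      unfolding f_fun_def by (intro DERIV_diff DERIV_const DERIV_chain2[OF b_derivs(1)] dV')
    then show ?thesis using vmax by (simp add: Z_def Z_fun_def)
  qed
  have term': "((\<lambda>\<tau>. vmax\<^sup>2 / 2 * ((v \<tau> i - f (s \<tau>) i)\<^sup>2 / (v \<tau> i * (vmax - v \<tau> i)))) has_real_derivative
       e i * (dV n V (s t) i - dV n V (s t) (i + 1)) - \<mu> * vmax\<^sup>2 * ((e i)\<^sup>2 / y i)) (at t within I)"
    if i: "i \<in> {1..n}" for i
  proof -
    let ?F = "F (s t) (v t) i"
    have nz: "v t i \<noteq> 0" "vmax - v t i \<noteq> 0" using v0[OF i] by auto
    have "((\<lambda>\<tau>. (v \<tau> i - f (s \<tau>) i)\<^sup>2) has_real_derivative 2 * (v t i - f (s t) i) * (?F - Z i / vmax\<^sup>2)) (at t within I)"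
      by (auto intro!: derivative_eq_intros v'[OF i] f')
    moreover have "((\<lambda>\<tau>. v \<tau> i * (vmax - v \<tau> i)) has_real_derivative (?F * (vmax - v t i) - v t i * ?F)) (at t within I)"
      by (auto intro!: derivative_eq_intros v'[OF i])
    ultimately have "((\<lambda>\<tau>. vmax\<^sup>2 / 2 * ((v \<tau> i - f (s \<tau>) i)\<^sup>2 / (v \<tau> i * (vmax - v \<tau> i)))) has_real_derivative
        vmax\<^sup>2 / 2 * ((2 * (v t i - f (s t) i) * (?F - Z i / vmax\<^sup>2) * (v t i * (vmax - v t i))
           - (v t i - f (s t) i)\<^sup>2 * (?F * (vmax - v t i) - v t i * ?F)) /
            ((v t i * (vmax - v t i)) * (v t i * (vmax - v t i))))) (at t within I)"
      by (intro DERIV_cmult DERIV_divide) (use nz in auto)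
    also have "vmax\<^sup>2 / 2 * ((2 * (v t i - f (s t) i) * (?F - Z i / vmax\<^sup>2) * (v t i * (vmax - v t i))
           - (v t i - f (s t) i)\<^sup>2 * (?F * (vmax - v t i) - v t i * ?F)) /
            ((v t i * (vmax - v t i)) * (v t i * (vmax - v t i))))
        = beta vmax (v t i) (f (s t) i) * ?F * e i - vmax\<^sup>2 * e i * (Z i / vmax\<^sup>2) / y i"
      unfolding e_def y_def by (rule kinetic_term_deriv[OF nz])
    also have "beta vmax (v t i) (f (s t) i) * ?F
        = (Z i - \<mu> * vmax\<^sup>2 * e i) / y i + dV n V (s t) i - dV n V (s t) (i + 1)"
      using beta_pos[OF v0[OF i] f_bounds[of "s t" i]] by (simp add: F_fun_def Z_def e_def y_def)
    also have "((Z i - \<mu> * vmax\<^sup>2 * e i) / y i + dV n V (s t) i - dV n V (s t) (i + 1)) * e i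
          - vmax\<^sup>2 * e i * (Z i / vmax\<^sup>2) / y i
        = e i * (dV n V (s t) i - dV n V (s t) (i + 1)) - \<mu> * vmax\<^sup>2 * ((e i)\<^sup>2 / y i)"
      using vmax by (simp add: diff_divide_distrib algebra_simps power2_eq_square)
    finally show ?thesis .
  qed
  have V': "((\<lambda>\<tau>. V (s \<tau> i)) has_real_derivative deriv V (s t i) * (v t (i - 1) - v t i)) (at t within I)"
    if "i \<in> {2..n}" for i
    by (rule DERIV_chain2[OF V_derivs(1)[OF sL[OF that]] s'[OF that]])
  have "((\<lambda>\<tau>. (\<Sum>i=1..n. vmax\<^sup>2 / 2 * ((v \<tau> i - f (s \<tau>) i)\<^sup>2 / (v \<tau> i * (vmax - v \<tau> i)))) + (\<Sum>i=2..n. V (s \<tau> i)))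
      has_real_derivative
        (\<Sum>i=1..n. e i * (dV n V (s t) i - dV n V (s t) (i + 1)) - \<mu> * vmax\<^sup>2 * ((e i)\<^sup>2 / y i))
        + (\<Sum>i=2..n. deriv V (s t i) * (v t (i - 1) - v t i))) (at t within I)"
    by (intro DERIV_add DERIV_sum term' V')
  also have "(\<Sum>i=1..n. e i * (dV n V (s t) i - dV n V (s t) (i + 1)) - \<mu> * vmax\<^sup>2 * ((e i)\<^sup>2 / y i))
        + (\<Sum>i=2..n. deriv V (s t i) * (v t (i - 1) - v t i)) = - dissipation (s t) (v t)"
    using power_balance[of "v t" "s t"]
    by (simp add: sum_subtractf sum_distrib_left e_def y_def dissipation_def kinetic_def)
  finally show ?thesis by (simp add: H_fun_def sum_distrib_left)
qed

section \<open>Energy estimates\<close>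

text \<open>A bound on \<open>H\<close> bounds \<open>V (s i)\<close>, so the blow-up of \<open>V\<close> keeps the gaps away from \<open>L\<close>. Then the forces \<open>V'\<close> are
  bounded, the target speeds lie in a compact part of \<open>(0, vmax)\<close>, and \<open>boundary_layer\<close> applies. The gaps
  themselves may be arbitrarily large.\<close>
lemma sublevel_confined:
  assumes "0 \<le> h"
  obtains smin vlo vhi where "L < smin" "0 < vlo" "vhi < vmax"
    "\<And>s v i. (s, v) \<in> \<Omega> \<Longrightarrow> H s v \<le> h \<Longrightarrow> i \<in> {2..n} \<Longrightarrow> smin \<le> s i"
    "\<And>s v i. (s, v) \<in> \<Omega> \<Longrightarrow> H s v \<le> h \<Longrightarrow> i \<in> {1..n} \<Longrightarrow> vlo \<le> v i \<and> v i \<le> vhi"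
proof -
  have "\<forall>\<^sub>F x in at_right L. h < V x"
    using V_blowup by (simp add: filterlim_at_top_dense)
  then obtain smin where smin: "L < smin" "\<And>x. L < x \<Longrightarrow> x < smin \<Longrightarrow> h < V x"
    by (auto simp: eventually_at_right_field)
  have s_ge: "smin \<le> s i" if "(s, v) \<in> \<Omega>" "H s v \<le> h" "i \<in> {2..n}" for s v i
    using smin(2)[of "s i"] V_le_H[OF that(1,3)] that by (force simp: state_space_def)
  define P where "P = - deriv V smin"
  have P: "0 \<le> P" unfolding P_def using deriv_V_nonpos[OF smin(1)] by simp
  define g1 where "g1 = vstar - b P"
  define g2 where "g2 = vmax - (vstar - b (- P))"
  have g: "0 < g1" "0 < g2" unfolding g1_def g2_def using b_range(2)[of P] b_range(1)[of "-P"] by auto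
  have f_range: "g1 \<le> f s i \<and> g2 \<le> vmax - f s i" if "(s, v) \<in> \<Omega>" "H s v \<le> h" for s v i
  proof -
    have "- P \<le> dV n V s j \<and> dV n V s j \<le> 0" for j
      using dV_state_nonpos[OF that(1), of j] deriv_V_mono[OF smin(1) s_ge[OF that, of j]] P
      by (auto simp: dV_def P_def)
    from this[of i] this[of "i + 1"] have "- P \<le> p s i" "p s i \<le> P" by auto
    then have "b (- P) \<le> b (p s i)" "b (p s i) \<le> b P" by (auto simp: b_le_iff)
    then show ?thesis unfolding f_fun_def g1_def g2_def by auto
  qed
  define vlo where "vlo = min (g1 / 2) (g1\<^sup>2 * vmax / (8 * (h + 1)))"
  define gap where "gap = min (g2 / 2) (g2\<^sup>2 * vmax / (8 * (h + 1)))"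
  have v_range: "vlo \<le> v i \<and> v i \<le> vmax - gap" if sv: "(s, v) \<in> \<Omega>" "H s v \<le> h" "i \<in> {1..n}" for s v i
  proof -
    have v: "0 < v i" "v i < vmax" using sv by (auto simp: state_space_def)
    have "vmax\<^sup>2 / 2 * ((v i - f s i)\<^sup>2 / (v i * (vmax - v i))) \<le> h"
      using kinetic_term_le_H[OF sv(1,3)] sv(2) by linarith
    then have *: "(v i - f s i)\<^sup>2 * vmax\<^sup>2 \<le> 2 * h * (v i * (vmax - v i))"
      using v by (simp add: divide_simps mult_ac)
    have "vlo \<le> v i"
      unfolding vlo_def using f_range[OF sv(1,2)] v assms g * by (intro boundary_layer[of _ _ _ _ "f s i"]) auto
    moreover have "gap \<le> vmax - v i"
      unfolding gap_def
    proof (rule boundary_layer[of _ _ _ _ "vmax - f s i"])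
      show "(vmax - v i - (vmax - f s i))\<^sup>2 * vmax\<^sup>2 \<le> 2 * h * ((vmax - v i) * (vmax - (vmax - v i)))"
        using * by (simp add: power2_commute mult_ac)
    qed (use f_range[OF sv(1,2)] v assms g in auto)
    ultimately show ?thesis by simp
  qed
  have "0 < vlo" "vmax - gap < vmax" unfolding vlo_def gap_def using g assms vmax by auto
  then show thesis using that[OF smin(1)] s_ge v_range by blast
qed

text \<open>If \<open>H\<close> is not small, then either its kinetic part is not small, and the dissipation contains that part, or
  some \<open>V (s k)\<close> is not small. In the second case \<open>s k\<close> is well below \<open>lam\<close>, so \<open>V' (s k)\<close> is bounded
  away from zero because \<open>V'\<close> is increasing. As \<open>V' (s k)\<close> is the sum of the force differences \<open>p s i\<close> for \<open>i < k\<close>, one of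
  them is not small, and \<open>x * b x\<close> is bounded below for such \<open>x\<close>. The constant is independent of
  the size of \<open>H\<close> and of the gaps, which replaces compactness.\<close>
lemma dissipation_lower_bound:
  assumes "0 < \<delta>"
  shows "\<exists>c>0. \<forall>x\<in>\<Omega>. \<delta> \<le> H (fst x) (snd x) \<longrightarrow> c \<le> dissipation (fst x) (snd x)"
proof -
  define c0 where "c0 = \<delta> / (2 * n)"
  have c0: "0 < c0" unfolding c0_def using assms n by simp
  obtain x0 where x0: "L < x0" "x0 < lam" "\<bar>V x0\<bar> < c0"
    using small_left_of_lam[OF DERIV_isCont[OF V_derivs(1)[OF L_lam]] V_zero c0] by auto
  \<comment> \<open>a gap with \<open>V \<ge> c0\<close> lies left of \<open>x0\<close>, so its force is at least \<open>n * r\<close> and, being a sum of fewer than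
    \<open>n\<close> differences, has a difference of size at least \<open>r\<close>\<close>
  define r where "r = - deriv V x0 / n"
  have r: "0 < r" unfolding r_def using dV_neg[OF x0(1,2)] n by (intro divide_pos_pos) auto
  define c where "c = min (\<mu> * \<delta>) (min (r * b r) ((- r) * b (- r)))"
  have "0 < c" unfolding c_def using \<mu> assms b_sign[of r] b_sign[of "-r"] r by auto
  moreover have "c \<le> dissipation s v" if sv: "(s, v) \<in> \<Omega>" and H: "\<delta> \<le> H s v" for s v
  proof (cases "\<delta> / 2 \<le> vmax\<^sup>2 / 2 * kinetic s v")
    case True
    have "c \<le> \<mu> * \<delta>" unfolding c_def by simp
    also have "\<dots> \<le> \<mu> * (vmax\<^sup>2 * kinetic s v)" using True \<mu> by (intro mult_left_mono) auto
    also have "\<dots> \<le> dissipation s v"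
      unfolding dissipation_def by (simp add: sum_nonneg mult_b_nonneg mult.assoc)
    finally show ?thesis .
  next
    case False
    then have sumV: "\<delta> / 2 < (\<Sum>i=2..n. V (s i))" using H unfolding H_eq by linarith
    have "\<exists>k\<in>{2..n}. c0 \<le> V (s k)"
    proof (rule ccontr)
      assume "\<not> ?thesis"
      then have "(\<Sum>i=2..n. V (s i)) \<le> of_nat (card {2..n}) * c0"
        by (intro sum_bounded_above) (auto simp: not_le less_imp_le)
      also have "\<dots> \<le> n * c0" using c0 by (intro mult_right_mono) auto
      also have "\<dots> = \<delta> / 2" unfolding c0_def using n by simp
      finally show False using sumV by simp
    qed
    then obtain k where k: "k \<in> {2..n}" "c0 \<le> V (s k)" by blast
    have "L < s k" using sv k by (auto simp: state_space_def)
    then have "s k < x0" using V_antimono[of x0 "s k"] x0 k(2) by linarith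
    then have "deriv V (s k) \<le> deriv V x0" using \<open>L < s k\<close> by (intro deriv_V_mono) auto
    then have dVk: "n * r \<le> \<bar>dV n V s k\<bar>" unfolding r_def dV_def using k(1) n by simp
    have "(\<Sum>i=1..k-1. p s i) = dV n V s k - dV n V s 1"
      using sum_Suc_diff[of 1 "k - 1" "dV n V s"] k(1) by simp
    then have tele: "dV n V s k = (\<Sum>i=1..k-1. p s i)" unfolding dV_boundary by simp
    have "\<exists>i\<in>{1..k-1}. r \<le> \<bar>p s i\<bar>"
    proof (rule ccontr)
      assume "\<not> ?thesis"
      then have small: "\<And>i. i \<in> {1..k-1} \<Longrightarrow> \<bar>p s i\<bar> \<le> r" by force
      have "\<bar>dV n V s k\<bar> \<le> (\<Sum>i=1..k-1. \<bar>p s i\<bar>)" unfolding tele by (rule sum_abs)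
      also have "\<dots> \<le> of_nat (card {1..k-1}) * r" by (intro sum_bounded_above small)
      also have "\<dots> < n * r" using r k(1) by (intro mult_strict_right_mono) auto
      finally show False using dVk by simp
    qed
    then obtain i where i: "i \<in> {1..k-1}" "r \<le> \<bar>p s i\<bar>" by blast
    have "min (r * b r) ((- r) * b (- r)) \<le> p s i * b (p s i)"
    proof (cases "0 \<le> p s i")
      case True
      have "r * b r \<le> p s i * b (p s i)"
        using i True r b_sign[of r] b_le_iff[of r "p s i"] by (intro mult_mono) (auto simp: zero_less_mult_iff)
      then show ?thesis by simp
    next
      case False
      then have "p s i \<le> - r" using i by auto
      then have "(- (- r)) * (- b (- r)) \<le> (- p s i) * (- b (p s i))"
        using r b_sign[of "-r"] b_le_iff[of "p s i" "-r"] by (intro mult_mono) (auto simp: mult_less_0_iff)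
      then have "(- r) * b (- r) \<le> p s i * b (p s i)" by (simp only: minus_mult_minus minus_minus)
      then show ?thesis by simp
    qed
    also have "\<dots> \<le> (\<Sum>i=1..n. p s i * b (p s i))"
      using i k(1) mult_b_nonneg by (intro member_le_sum) auto
    also have "\<dots> \<le> dissipation s v"
      unfolding dissipation_def using kinetic_nonneg[OF sv] \<mu> by simp
    finally show ?thesis unfolding c_def by simp
  qed
  ultimately show ?thesis by (intro exI[of _ c]) auto
qed

text \<open>An explicit upper bound of the distance to the equilibria, easier to handle than the infimum.\<close>
definition deviation :: "vec \<Rightarrow> vec \<Rightarrow> real" where
  "deviation s v = (\<Sum>i=2..n. max 0 (lam - s i)) + (\<Sum>i=1..n. \<bar>v i - vstar\<bar>)"

lemma dist_to_nonneg: "0 \<le> dist_to n x (equilibria n lam vstar)"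
proof -
  have "((\<lambda>_. lam), (\<lambda>_. vstar)) \<in> equilibria n lam vstar" by (simp add: equilibria_def)
  then show ?thesis
    unfolding dist_to_def by (intro cINF_greatest) (auto simp: state_dist_def intro!: add_nonneg_nonneg sum_nonneg)
qed

lemma dist_to_le_deviation: "dist_to n (s, v) (equilibria n lam vstar) \<le> deviation s v"
proof -
  let ?y = "((\<lambda>i. max (s i) lam), (\<lambda>_. vstar))"
  have "dist_to n (s, v) (equilibria n lam vstar) \<le> state_dist n (s, v) ?y"
    unfolding dist_to_def
  proof (rule cINF_lower)
    show "bdd_below (state_dist n (s, v) ` equilibria n lam vstar)"
      by (rule bdd_belowI[of _ 0]) (auto simp: state_dist_def intro!: add_nonneg_nonneg sum_nonneg)
    show "?y \<in> equilibria n lam vstar" by (simp add: equilibria_def)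
  qed
  also have "\<dots> \<le> sqrt (\<Sum>i=2..n. (s i - max (s i) lam)\<^sup>2) + sqrt (\<Sum>i=1..n. (v i - vstar)\<^sup>2)"
    unfolding state_dist_def fst_conv snd_conv by (intro sqrt_add_le_add_sqrt sum_nonneg) auto
  also have "\<dots> \<le> (\<Sum>i=2..n. \<bar>s i - max (s i) lam\<bar>) + (\<Sum>i=1..n. \<bar>v i - vstar\<bar>)"
    unfolding L2_set_def[symmetric] by (intro add_mono L2_set_le_sum_abs)
  also have "(\<Sum>i=2..n. \<bar>s i - max (s i) lam\<bar>) = (\<Sum>i=2..n. max 0 (lam - s i))"
    by (intro sum.cong) auto
  finally show ?thesis by (simp add: deviation_def)
qed

lemma deviation_bounded:
  assumes "(s, v) \<in> \<Omega>"
  shows "deviation s v \<le> n * (lam - L) + n * vmax"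
proof -
  have "max 0 (lam - s i) \<le> lam - L" if "i \<in> {2..n}" for i
  proof -
    have "L < s i" using assms that by (auto simp: state_space_def)
    then show ?thesis using L_lam by simp
  qed
  then have "(\<Sum>i=2..n. max 0 (lam - s i)) \<le> of_nat (card {2..n}) * (lam - L)"
    by (intro sum_bounded_above)
  also have "\<dots> \<le> n * (lam - L)" using L_lam by (intro mult_right_mono) auto
  finally have "(\<Sum>i=2..n. max 0 (lam - s i)) \<le> n * (lam - L)" .
  moreover have "\<bar>v i - vstar\<bar> \<le> vmax" if "i \<in> {1..n}" for i
  proof -
    have "0 < v i" "v i < vmax" using assms that by (auto simp: state_space_def)
    then show ?thesis using vstar by linarith
  qed
  then have "(\<Sum>i=1..n. \<bar>v i - vstar\<bar>) \<le> of_nat (card {1..n}) * vmax"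
    by (intro sum_bounded_above)
  ultimately show ?thesis unfolding deviation_def by simp
qed

text \<open>If \<open>H\<close> is small, no gap is much below \<open>lam\<close>, so the forces and hence the differences of the target
  speeds from \<open>vstar\<close> are small. What is left of the deviation is a speed away from its target, which the
  kinetic part of \<open>H\<close> detects since \<open>v (vmax - v) \<le> vmax\<^sup>2 / 4\<close>.\<close>
lemma H_lower_bound:
  assumes "0 < \<delta>"
  shows "\<exists>c>0. \<forall>x\<in>\<Omega>. \<delta> \<le> deviation (fst x) (snd x) \<longrightarrow> c \<le> H (fst x) (snd x)"
proof -
  \<comment> \<open>if every gap contributes at most \<open>\<epsilon>\<close> and every speed at most \<open>2 * \<epsilon>\<close>, the deviation is at most \<open>3 * n * \<epsilon>\<close>\<close>
  define \<epsilon> where "\<epsilon> = \<delta> / (4 * n)"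
  have \<epsilon>: "0 < \<epsilon>" unfolding \<epsilon>_def using assms n by simp
  have "isCont b 0" by (rule DERIV_isCont[OF b_derivs(1)])
  then obtain \<eta> where \<eta>: "0 < \<eta>" "\<And>x. \<bar>x\<bar> < \<eta> \<Longrightarrow> \<bar>b x\<bar> < \<epsilon>"
    using \<epsilon> unfolding continuous_at_eps_delta by (force simp: dist_real_def b0)
  obtain x0 where x0: "L < x0" "x0 < lam" "\<bar>deriv V x0\<bar> < \<eta> / 2"
    using small_left_of_lam[OF DERIV_isCont[OF V_derivs(2)[OF L_lam]] deriv_V_zero, of "\<eta> / 2"] \<eta>(1) by auto
  define x1 where "x1 = max x0 (lam - \<epsilon>)"
  have x1: "L < x1" "x1 < lam" "lam - \<epsilon> \<le> x1" "x0 \<le> x1" unfolding x1_def using x0 \<epsilon> by auto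
  have dx1: "- (\<eta> / 2) < deriv V x1" using deriv_V_mono[OF x0(1) x1(4)] x0(3) by linarith
  define c where "c = min (V x1) (2 * \<epsilon>\<^sup>2)"
  have "0 < c" unfolding c_def using V_pos[OF x1(1,2)] \<epsilon> by simp
  moreover have "c \<le> H s v" if sv: "(s, v) \<in> \<Omega>" and dev: "\<delta> \<le> deviation s v" for s v
  proof (cases "\<exists>k\<in>{2..n}. s k \<le> x1")
    case True
    then obtain k where k: "k \<in> {2..n}" "s k \<le> x1" by blast
    have "V x1 \<le> V (s k)" using sv k by (intro V_antimono) (auto simp: state_space_def)
    also have "\<dots> \<le> H s v" by (rule V_le_H[OF sv k(1)])
    finally show ?thesis unfolding c_def by simp
  next
    case False
    then have s: "\<And>i. i \<in> {2..n} \<Longrightarrow> x1 < s i" by force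
    have "- (\<eta> / 2) < dV n V s j \<and> dV n V s j \<le> 0" for j
      using dV_state_nonpos[OF sv, of j] deriv_V_mono[OF x1(1), of "s j"] s[of j] dx1 \<eta>(1)
      by (auto simp: dV_def)
    then have b_small: "\<bar>b (p s i)\<bar> < \<epsilon>" for i
      using \<eta>(2)[of "p s i"] by (smt (verit) field_sum_of_halves)
    have "\<exists>i\<in>{1..n}. \<epsilon> \<le> \<bar>v i - f s i\<bar>"
    proof (rule ccontr)
      assume no: "\<not> ?thesis"
      have "\<bar>v i - vstar\<bar> \<le> 2 * \<epsilon>" if "i \<in> {1..n}" for i
      proof -
        have "\<bar>v i - f s i\<bar> < \<epsilon>" using no that by force
        then show ?thesis using b_small[of i] unfolding f_fun_def by linarith
      qed
      then have "(\<Sum>i=1..n. \<bar>v i - vstar\<bar>) \<le> of_nat (card {1..n}) * (2 * \<epsilon>)"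
        by (intro sum_bounded_above)
      moreover have "max 0 (lam - s i) \<le> \<epsilon>" if "i \<in> {2..n}" for i
        using s[OF that] x1(3) \<epsilon> by linarith
      then have "(\<Sum>i=2..n. max 0 (lam - s i)) \<le> of_nat (card {2..n}) * \<epsilon>"
        by (intro sum_bounded_above)
      moreover have "of_nat (card {2..n}) * \<epsilon> \<le> n * \<epsilon>"
        using \<epsilon> by (intro mult_right_mono) auto
      ultimately have "deviation s v \<le> 3 * (n * \<epsilon>)" unfolding deviation_def by simp
      also have "\<dots> < 4 * (n * \<epsilon>)" using \<epsilon> n by simp
      also have "\<dots> = \<delta>" unfolding \<epsilon>_def using n by simp
      finally show False using dev by simp
    qed
    then obtain i where i: "i \<in> {1..n}" "\<epsilon> \<le> \<bar>v i - f s i\<bar>" by blast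
    have v: "0 < v i" "v i < vmax" using sv i by (auto simp: state_space_def)
    have den: "0 < v i * (vmax - v i)" using v by simp
    have "0 \<le> (vmax - 2 * v i)\<^sup>2" by simp
    then have am: "4 * (v i * (vmax - v i)) \<le> vmax\<^sup>2" by (simp add: power2_eq_square algebra_simps)
    have "\<epsilon>\<^sup>2 \<le> (v i - f s i)\<^sup>2" using i(2) \<epsilon> by (metis abs_le_square_iff abs_of_pos)
    then have "4 * (v i * (vmax - v i)) * \<epsilon>\<^sup>2 \<le> vmax\<^sup>2 * (v i - f s i)\<^sup>2"
      using am den by (intro mult_mono) auto
    then have "2 * \<epsilon>\<^sup>2 * (v i * (vmax - v i)) \<le> vmax\<^sup>2 / 2 * (v i - f s i)\<^sup>2" by (simp add: algebra_simps)
    then have "2 * \<epsilon>\<^sup>2 \<le> vmax\<^sup>2 / 2 * ((v i - f s i)\<^sup>2 / (v i * (vmax - v i)))"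
      using den by (simp only: pos_le_divide_eq times_divide_eq_right)
    also have "\<dots> \<le> H s v" by (rule kinetic_term_le_H[OF sv i(1)])
    finally show ?thesis unfolding c_def by simp
  qed
  ultimately show ?thesis by (intro exI[of _ c]) auto
qed

section \<open>Global solutions and decay\<close>

definition coord_range :: "nat \<Rightarrow> real set" where
  "coord_range j = (if j \<le> n then {L<..} else {0<..<vmax})"

text \<open>The closed loop as a field on one vector: coordinates \<open>2\<close> to \<open>n\<close> are the gaps, coordinate \<open>n + i\<close> is the
  speed of vehicle \<open>i\<close>, so the relevant indices are \<open>2\<close> to \<open>2 n\<close>.\<close>
definition closed_loop_field :: "(nat \<Rightarrow> real) \<Rightarrow> nat \<Rightarrow> real" where
  "closed_loop_field x j = (if j \<le> n then x (n + j - 1) - x (n + j) else F x (\<lambda>i. x (n + i)) (j - n))"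

text \<open>Here \<open>V\<close> is used up to its third and \<open>b\<close> up to its second derivative. In the merged vector
  \<open>v 0\<close> would read a gap and \<open>v (n + 1)\<close> an index that is no coordinate, but both carry the factor zero;
  this is why \<open>ahead\<close> and \<open>behind\<close> are treated as whole products.\<close>
lemma closed_loop_field_lipschitz_near:
  assumes x: "\<And>i. i \<in> {2..2*n} \<Longrightarrow> x i \<in> coord_range i" and j: "j \<in> {2..2*n}"
  shows "lipschitz_near {2..2*n} x (\<lambda>x. closed_loop_field x j)"
proof (cases "j \<le> n")
  case True
  have "lipschitz_near {2..2*n} x (\<lambda>x. x (n + j - 1) - x (n + j))"
    by (intro lipschitz_near_diff lipschitz_near_coordinate) (use True j n in auto)
  then show ?thesis using True by (simp add: closed_loop_field_def)
next
  case False
  define k where "k = j - n"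
  have k: "k \<in> {1..n}" "j = n + k" using False j by (auto simp: k_def)
  let ?lip = "lipschitz_near {2..2*n} x"
  let ?v = "\<lambda>x i. x (n + i)"
  have v: "?lip (\<lambda>x. x (n + i))" if "i \<in> {1..n}" for i
    by (intro lipschitz_near_coordinate) (use that n in auto)
  have vk: "0 < x (n + k)" "x (n + k) < vmax" using x[of "n + k"] k(1) n by (auto simp: coord_range_def)
  have s: "?lip (\<lambda>x. x i)" "x i \<in> {L<..}" if "i \<in> {2..n}" for i
    using that x[of i] by (auto simp: coord_range_def)
  have cont_ddV: "continuous_on {L<..} (deriv (deriv V))"
    by (intro DERIV_continuous_on[OF has_field_derivative_at_within[OF V_derivs(3)]]) auto
  have dV: "?lip (\<lambda>x. dV n V x i)" for i
    unfolding dV_def using lipschitz_near_compose[OF s(1) _ open_greaterThan s(2) V_derivs(2) cont_ddV]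
    by (cases "i \<in> {2..n}") auto
  have ddV: "?lip (\<lambda>x. ddV n V x i)" for i
    unfolding ddV_def using lipschitz_near_compose[OF s(1) _ open_greaterThan s(2) V_derivs(3) dddV_continuous]
    by (cases "i \<in> {2..n}") auto
  have p: "?lip (\<lambda>x. p x k)" by (intro lipschitz_near_diff dV) auto
  have cont_db: "continuous_on UNIV (deriv b)"
    by (intro DERIV_continuous_on[OF has_field_derivative_at_within[OF b_derivs(2)]])
  have b: "?lip (\<lambda>x. b (p x k))"
    by (rule lipschitz_near_compose[OF p _ open_UNIV _ b_derivs(1) cont_db]) auto
  have db: "?lip (\<lambda>x. deriv b (p x k))"
    by (rule lipschitz_near_compose[OF p _ open_UNIV _ b_derivs(2) ddb_continuous]) auto
  have f: "?lip (\<lambda>x. f x k)"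
    unfolding f_fun_def by (intro lipschitz_near_diff lipschitz_near_const b) auto
  have ahead: "?lip (\<lambda>x. ddV n V x (k + 1) * (?v x k - ?v x (k + 1)))"
  proof (cases "k + 1 \<in> {2..n}")
    case True
    then show ?thesis using k by (intro lipschitz_near_mult lipschitz_near_diff v ddV) auto
  qed (auto simp: ddV_def)
  have behind: "?lip (\<lambda>x. ddV n V x k * (?v x (k - 1) - ?v x k))"
  proof (cases "k \<in> {2..n}")
    case True
    then show ?thesis using k by (intro lipschitz_near_mult lipschitz_near_diff v ddV) auto
  qed (auto simp: ddV_def)
  have Z: "?lip (\<lambda>x. Z_fun n vmax V b x (?v x) k)"
    unfolding Z_fun_def
    by (intro lipschitz_near_mult lipschitz_near_diff lipschitz_near_const ahead behind db) auto
  have beta: "?lip (\<lambda>x. beta vmax (?v x k) (f x k))"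
    unfolding beta_def power2_eq_square
    by (intro lipschitz_near_divide lipschitz_near_mult lipschitz_near_diff lipschitz_near_add
        lipschitz_near_const v k(1) f) (use vk in auto)
  have "?lip (\<lambda>x. F x (?v x) k)"
    unfolding F_fun_def
    by (intro lipschitz_near_divide lipschitz_near_mult lipschitz_near_diff lipschitz_near_add
        lipschitz_near_const v k(1) f dV Z beta) (use vk beta_pos[OF vk f_bounds[of x k]] in auto)
  then show ?thesis using k by (simp add: closed_loop_field_def)
qed

lemma F_cong:
  assumes "\<And>i. i \<in> {2..n} \<Longrightarrow> s i = s' i" "\<And>i. i \<in> {1..n} \<Longrightarrow> v i = v' i" "k \<in> {1..n}"
  shows "F s v k = F s' v' k"
proof -
  have dV: "dV n V s i = dV n V s' i" for i unfolding dV_def using assms(1)[of i] by auto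
  have ahead: "ddV n V s (k + 1) * (v k - v (k + 1)) = ddV n V s' (k + 1) * (v' k - v' (k + 1))"
    unfolding ddV_def using assms(1)[of "k + 1"] assms(2)[of k] assms(2)[of "k + 1"] assms(3) by auto
  have behind: "ddV n V s k * (v (k - 1) - v k) = ddV n V s' k * (v' (k - 1) - v' k)"
  proof (cases "k \<in> {2..n}")
    case True
    then have "k - 1 \<in> {1..n}" by auto
    then show ?thesis using True assms(1)[of k] assms(2)[of k] assms(2)[of "k - 1"] assms(3) by (simp add: ddV_def)
  qed (auto simp: ddV_def)
  show ?thesis
    unfolding F_fun_def Z_fun_def f_fun_def dV ahead behind
    unfolding assms(2)[OF assms(3)] ..
qed

lemma H_along_solution:
  assumes sol: "closed_loop_solution n L vmax vstar \<mu> V b I s v" and t: "t \<in> I"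
  shows "((\<lambda>\<tau>. H (s \<tau>) (v \<tau>)) has_real_derivative - dissipation (s t) (v t)) (at t within I)"
  using sol t unfolding closed_loop_solution_def by (intro H_has_derivative) auto

lemma solution_interval:
  assumes "closed_loop_solution n L vmax vstar \<mu> V b I s v" "t \<in> I"
  shows "{0..t} \<subseteq> I" "0 \<le> t"
  using assms unfolding closed_loop_solution_def is_interval_1 by auto

lemma H_derivative_inside:
  assumes sol: "closed_loop_solution n L vmax vstar \<mu> V b I s v" and t: "t \<in> I" "0 < \<tau>" "\<tau> < t"
  shows "((\<lambda>\<tau>. H (s \<tau>) (v \<tau>)) has_real_derivative - dissipation (s \<tau>) (v \<tau>)) (at \<tau>)"
proof -
  have "\<tau> \<in> interior {0..t}" using t by simp
  then have "\<tau> \<in> interior I" using interior_mono[OF solution_interval(1)[OF sol t(1)]] by blast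
  then show ?thesis
    using H_along_solution[OF sol, of \<tau>] at_within_interior[of \<tau> I] interior_subset by auto
qed

lemma H_continuous_on:
  assumes sol: "closed_loop_solution n L vmax vstar \<mu> V b I s v" and t: "t \<in> I"
  shows "continuous_on {0..t} (\<lambda>\<tau>. H (s \<tau>) (v \<tau>))"
  by (rule continuous_on_subset[OF DERIV_continuous_on solution_interval(1)[OF sol t]])
    (rule H_along_solution[OF sol])

lemma solution_in_state_space:
  "closed_loop_solution n L vmax vstar \<mu> V b I s v \<Longrightarrow> t \<in> I \<Longrightarrow> (s t, v t) \<in> \<Omega>"
  unfolding closed_loop_solution_def by blast

lemma H_nonincreasing:
  assumes sol: "closed_loop_solution n L vmax vstar \<mu> V b I s v" and t: "t \<in> I"
  shows "H (s t) (v t) \<le> H (s 0) (v 0)"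
proof (rule DERIV_nonpos_imp_decreasing_open[OF solution_interval(2)[OF sol t]])
  show "\<exists>d. ((\<lambda>\<tau>. H (s \<tau>) (v \<tau>)) has_real_derivative d) (at \<tau>) \<and> d \<le> 0" if "0 < \<tau>" "\<tau> < t" for \<tau>
  proof (intro exI conjI)
    have "\<tau> \<in> I" using solution_interval(1)[OF sol t] that by auto
    then show "- dissipation (s \<tau>) (v \<tau>) \<le> 0"
      using dissipation_nonneg solution_in_state_space[OF sol] by simp
  qed (rule H_derivative_inside[OF sol t that])
qed (rule H_continuous_on[OF sol t])

text \<open>Since \<open>H\<close> does not increase, \<open>sublevel_confined\<close> bounds the speeds on both sides and the gaps from
  below; in bounded time the gaps also stay bounded above because the speeds do. So a solution on a
  bounded interval would be continued by \<open>ode_solution_continues\<close>.\<close>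
lemma maximal_solution_global:
  assumes "maximal_closed_loop_solution n L vmax vstar \<mu> V b I s v"
  shows "I = {0..}"
proof (rule ccontr)
  assume not_all: "I \<noteq> {0..}"
  have sol: "closed_loop_solution n L vmax vstar \<mu> V b I s v"
    and maximal: "\<And>J s' v'. \<lbrakk>closed_loop_solution n L vmax vstar \<mu> V b J s' v'; I \<subseteq> J;
      \<And>t i. t \<in> I \<Longrightarrow> i \<in> {2..n} \<Longrightarrow> s' t i = s t i; \<And>t i. t \<in> I \<Longrightarrow> i \<in> {1..n} \<Longrightarrow> v' t i = v t i\<rbrakk> \<Longrightarrow> J = I"
    using assms unfolding maximal_closed_loop_solution_def by blast+
  have I: "is_interval I" "0 \<in> I" "I \<subseteq> {0..}"
    and s': "\<And>t i. t \<in> I \<Longrightarrow> i \<in> {2..n} \<Longrightarrow> ((\<lambda>\<tau>. s \<tau> i) has_real_derivative v t (i - 1) - v t i) (at t within I)"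
    and v': "\<And>t i. t \<in> I \<Longrightarrow> i \<in> {1..n} \<Longrightarrow> ((\<lambda>\<tau>. v \<tau> i) has_real_derivative F (s t) (v t) i) (at t within I)"
    using sol unfolding closed_loop_solution_def by blast+
  have vb: "0 < v t i \<and> v t i < vmax" if "t \<in> I" "i \<in> {1..n}" for t i
    using solution_in_state_space[OF sol that(1)] that(2) by (auto simp: state_space_def)
  obtain T where T: "\<And>t. t \<in> I \<Longrightarrow> t \<le> T"
  proof (cases "bdd_above I")
    case False
    have "{0..} \<subseteq> I"
    proof
      fix t :: real assume t: "t \<in> {0..}"
      obtain t' where "t' \<in> I" "t < t'" using False unfolding bdd_above_def by (meson not_le)
      then show "t \<in> I" using solution_interval(1)[OF sol, of t'] t by auto
    qed
    then show thesis using not_all I(3) by blast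
  qed (auto simp: bdd_above_def)
  obtain smin vlo vhi where conf: "L < smin" "0 < vlo" "vhi < vmax"
    "\<And>t i. t \<in> I \<Longrightarrow> i \<in> {2..n} \<Longrightarrow> smin \<le> s t i"
    "\<And>t i. t \<in> I \<Longrightarrow> i \<in> {1..n} \<Longrightarrow> vlo \<le> v t i \<and> v t i \<le> vhi"
    by (rule sublevel_confined[OF H_nonneg[OF solution_in_state_space[OF sol I(2)]]])
      (use solution_in_state_space[OF sol] H_nonincreasing[OF sol] in blast)
  have s_le: "s t i \<le> s 0 i + vmax * T" if "t \<in> I" "i \<in> {2..n}" for t i
  proof -
    have "norm (s t i - s 0 i) \<le> vmax * norm (t - 0)"
    proof (rule field_differentiable_bound[of I _ "\<lambda>t. v t (i - 1) - v t i"])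
      show "norm (v t (i - 1) - v t i) \<le> vmax" if "t \<in> I" for t
      proof -
        have "i \<in> {1..n}" "i - 1 \<in> {1..n}" using \<open>i \<in> {2..n}\<close> by auto
        from vb[OF that this(1)] vb[OF that this(2)] show ?thesis unfolding real_norm_def by linarith
      qed
    qed (use that I s' is_interval_convex_1 in auto)
    also have "\<dots> \<le> vmax * T" using vmax T[OF that(1)] I(3) that(1) by (intro mult_left_mono) auto
    finally show ?thesis by (simp add: abs_le_iff)
  qed
  define u where "u t j = (if j \<le> n then s t j else v t (j - n))" for t j
  define C where "C j = (if j \<le> n then {smin..s 0 j + vmax * T} else {vlo..vhi})" for j
  have u_field: "closed_loop_field (u t) j = (if j \<le> n then v t (j - 1) - v t j else F (s t) (v t) (j - n))"
    if "j \<in> {2..2*n}" for t j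
  proof (cases "j \<le> n")
    case True
    then show ?thesis using that by (auto simp: closed_loop_field_def u_def)
  next
    case False
    then have "F (u t) (\<lambda>i. u t (n + i)) (j - n) = F (s t) (v t) (j - n)"
      using that by (intro F_cong) (auto simp: u_def)
    then show ?thesis using False by (simp add: closed_loop_field_def)
  qed
  have u_sol: "solves_ode {2..2*n} closed_loop_field I u"
    unfolding solves_ode_def
  proof (intro ballI)
    fix t j assume t: "t \<in> I" and j: "j \<in> {2..2*n}"
    show "((\<lambda>\<tau>. u \<tau> j) has_real_derivative closed_loop_field (u t) j) (at t within I)"
    proof (cases "j \<le> n")
      case True
      then show ?thesis unfolding u_field[OF j] using s'[OF t, of j] j by (simp add: u_def)
    next
      case False
      then have "j - n \<in> {1..n}" using j by auto
      then show ?thesis unfolding u_field[OF j] using v'[OF t, of "j - n"] False by (simp add: u_def)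
    qed
  qed
  obtain J w where J: "is_interval J" "I \<subset> J" "J \<subseteq> {0..}"
    and wu: "\<And>t i. t \<in> I \<Longrightarrow> i \<in> {2..2*n} \<Longrightarrow> w t i = u t i"
    and wr: "\<And>t i. t \<in> J \<Longrightarrow> i \<in> {2..2*n} \<Longrightarrow> w t i \<in> coord_range i"
    and w_sol: "solves_ode {2..2*n} closed_loop_field J w"
  proof (rule ode_solution_continues[of "{2..2*n}" coord_range closed_loop_field I C u])
    show "lipschitz_near {2..2*n} x (\<lambda>x. closed_loop_field x j)"
      if "\<And>i. i \<in> {2..2*n} \<Longrightarrow> x i \<in> coord_range i" "j \<in> {2..2*n}" for x j
      by (rule closed_loop_field_lipschitz_near[OF that])
    show "bdd_above I" using T by (rule bdd_aboveI)
    show "u t i \<in> C i" if "t \<in> I" "i \<in> {2..2*n}" for t i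
    proof (cases "i \<le> n")
      case True
      then show ?thesis using conf(4)[OF that(1), of i] s_le[OF that(1), of i] that(2) by (simp add: u_def C_def)
    next
      case False
      then have "i - n \<in> {1..n}" using that(2) by auto
      then show ?thesis using conf(5)[OF that(1), of "i - n"] False by (simp add: u_def C_def)
    qed
    show "open (coord_range i)" for i by (simp add: coord_range_def)
    show "compact (C i)" for i by (simp add: C_def)
    show "C i \<subseteq> coord_range i" for i using conf(1-3) by (auto simp: C_def coord_range_def)
  qed (use I u_sol in auto)
  have "closed_loop_solution n L vmax vstar \<mu> V b J w (\<lambda>t i. w t (n + i))"
    unfolding closed_loop_solution_def
  proof (intro conjI ballI)
    fix t assume t: "t \<in> J"
    have "L < w t i" if "i \<in> {2..n}" for i
      using wr[OF t, of i] that by (simp add: coord_range_def)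
    moreover have "0 < w t (n + i) \<and> w t (n + i) < vmax" if "i \<in> {1..n}" for i
      using wr[OF t, of "n + i"] that n by (simp add: coord_range_def)
    ultimately show "(w t, \<lambda>i. w t (n + i)) \<in> \<Omega>" by (simp add: state_space_def)
    show "((\<lambda>\<tau>. w \<tau> i) has_real_derivative w t (n + (i - 1)) - w t (n + i)) (at t within J)" if "i \<in> {2..n}" for i
    proof -
      have "i \<in> {2..2*n}" using that by simp
      then have "((\<lambda>\<tau>. w \<tau> i) has_real_derivative closed_loop_field (w t) i) (at t within J)"
        using w_sol t unfolding solves_ode_def by blast
      then show ?thesis using that by (simp add: closed_loop_field_def)
    qed
    show "((\<lambda>\<tau>. w \<tau> (n + i)) has_real_derivative F (w t) (\<lambda>i. w t (n + i)) i) (at t within J)" if "i \<in> {1..n}" for i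
    proof -
      have "n + i \<in> {2..2*n}" using that n by auto
      then have "((\<lambda>\<tau>. w \<tau> (n + i)) has_real_derivative closed_loop_field (w t) (n + i)) (at t within J)"
        using w_sol t unfolding solves_ode_def by blast
      then show ?thesis using that by (simp add: closed_loop_field_def)
    qed
  qed (use J I in auto)
  then have "J = I"
  proof (rule maximal)
    show "w t i = s t i" if "t \<in> I" "i \<in> {2..n}" for t i using wu[of t i] that by (simp add: u_def)
    show "w t (n + i) = v t i" if "t \<in> I" "i \<in> {1..n}" for t i using wu[of t "n + i"] that n by (simp add: u_def)
  qed (use J(2) in auto)
  then show False using J(2) by blast
qed

theorem uniform_convergence:
  "\<exists>\<sigma> a. class_KL \<sigma> \<and> class_K_inf a \<and>
    (\<forall>I s v. maximal_closed_loop_solution n L vmax vstar \<mu> V b I s v \<longrightarrow>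
       I = {0..} \<and>
       (\<forall>t\<ge>0. a (dist_to n (s t, v t) (equilibria n lam vstar)) \<le> H (s t) (v t) \<and>
               H (s t) (v t) \<le> \<sigma> (H (s 0) (v 0)) t))"
proof -
  have "((\<lambda>_. lam), (\<lambda>_. vstar)) \<in> \<Omega>" using L_lam vstar by (simp add: state_space_def)
  then have ne: "\<Omega> \<noteq> {}" by blast
  obtain a where a: "class_K_inf a" "\<And>x. x \<in> \<Omega> \<Longrightarrow> a (deviation (fst x) (snd x)) \<le> H (fst x) (snd x)"
  proof (rule class_K_inf_lower_bound[OF ne, of "\<lambda>x. H (fst x) (snd x)" "\<lambda>x. deviation (fst x) (snd x)" "n * (lam - L) + n * vmax"])
    show "0 \<le> deviation (fst x) (snd x)" for x
      unfolding deviation_def by (intro add_nonneg_nonneg sum_nonneg) auto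
  qed (use H_nonneg deviation_bounded H_lower_bound in auto)
  have a_dist: "a (dist_to n (s, v) (equilibria n lam vstar)) \<le> H s v" if "(s, v) \<in> \<Omega>" for s v
  proof -
    have "mono_on {0..} a"
      using a(1) unfolding class_K_inf_def class_K_def by (blast intro: strict_mono_on_imp_mono_on)
    then have "a (dist_to n (s, v) (equilibria n lam vstar)) \<le> a (deviation s v)"
      by (rule mono_onD) (use dist_to_nonneg[of "(s, v)"] dist_to_le_deviation[of s v] in auto)
    then show ?thesis using a(2)[OF that] by simp
  qed
  obtain \<alpha> where \<alpha>: "continuous_on UNIV \<alpha>" "\<And>r. 0 < r \<Longrightarrow> 0 < \<alpha> r"
    "\<And>x. x \<in> \<Omega> \<Longrightarrow> \<alpha> (H (fst x) (snd x)) \<le> dissipation (fst x) (snd x)"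
    by (rule lower_envelope[OF ne, of "\<lambda>x. dissipation (fst x) (snd x)" "\<lambda>x. H (fst x) (snd x)"])
      (use dissipation_nonneg dissipation_lower_bound in auto)
  \<comment> \<open>capping by the identity, as \<open>class_KL_decay\<close> requires; this forbids extinction in finite time\<close>
  define \<omega> where "\<omega> r = min r (\<alpha> r)" for r
  obtain \<sigma> where \<sigma>: "class_KL \<sigma>" and decay:
    "\<And>y y' t. \<lbrakk>0 \<le> t; continuous_on {0..t} y; \<And>\<tau>. 0 \<le> \<tau> \<Longrightarrow> \<tau> \<le> t \<Longrightarrow> 0 \<le> y \<tau>;
       \<And>\<tau>. 0 < \<tau> \<Longrightarrow> \<tau> < t \<Longrightarrow> (y has_real_derivative y' \<tau>) (at \<tau>);
       \<And>\<tau>. 0 < \<tau> \<Longrightarrow> \<tau> < t \<Longrightarrow> y' \<tau> \<le> 0;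
       \<And>\<tau>. 0 < \<tau> \<Longrightarrow> \<tau> < t \<Longrightarrow> 0 < y \<tau> \<Longrightarrow> y' \<tau> \<le> - \<omega> (y \<tau>)\<rbrakk> \<Longrightarrow> y t \<le> \<sigma> (y 0) t"
  proof (rule class_KL_decay[of \<omega>])
    show "continuous_on {0<..} \<omega>"
      unfolding \<omega>_def by (intro continuous_intros continuous_on_subset[OF \<alpha>(1)]) auto
  qed (use \<alpha>(2) in \<open>auto simp: \<omega>_def\<close>)
  have "I = {0..} \<and> (\<forall>t\<ge>0. a (dist_to n (s t, v t) (equilibria n lam vstar)) \<le> H (s t) (v t) \<and>
               H (s t) (v t) \<le> \<sigma> (H (s 0) (v 0)) t)"
    if max: "maximal_closed_loop_solution n L vmax vstar \<mu> V b I s v" for I s v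
  proof (intro conjI allI impI)
    show I: "I = {0..}" by (rule maximal_solution_global[OF max])
    have sol: "closed_loop_solution n L vmax vstar \<mu> V b I s v"
      using max unfolding maximal_closed_loop_solution_def by blast
    have state: "(s t, v t) \<in> \<Omega>" if "0 \<le> t" for t
      using solution_in_state_space[OF sol] that by (simp add: I)
    fix t :: real assume t: "0 \<le> t"
    then have "t \<in> I" by (simp add: I)
    show "a (dist_to n (s t, v t) (equilibria n lam vstar)) \<le> H (s t) (v t)" by (rule a_dist[OF state[OF t]])
    show "H (s t) (v t) \<le> \<sigma> (H (s 0) (v 0)) t"
    proof (rule decay[OF t, of "\<lambda>t. H (s t) (v t)" "\<lambda>t. - dissipation (s t) (v t)"])
      show "continuous_on {0..t} (\<lambda>t. H (s t) (v t))" by (rule H_continuous_on[OF sol \<open>t \<in> I\<close>])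
      fix \<tau> :: real
      show "0 \<le> H (s \<tau>) (v \<tau>)" if "0 \<le> \<tau>" by (rule H_nonneg[OF state[OF that]])
      assume \<tau>: "0 < \<tau>" "\<tau> < t"
      have st: "(s \<tau>, v \<tau>) \<in> \<Omega>" by (rule state) (use \<tau> in simp)
      show "((\<lambda>t. H (s t) (v t)) has_real_derivative - dissipation (s \<tau>) (v \<tau>)) (at \<tau>)"
        by (rule H_derivative_inside[OF sol \<open>t \<in> I\<close> \<tau>])
      show "- dissipation (s \<tau>) (v \<tau>) \<le> 0" using dissipation_nonneg[OF st] by simp
      show "- dissipation (s \<tau>) (v \<tau>) \<le> - \<omega> (H (s \<tau>) (v \<tau>))"
        using \<alpha>(3)[OF st] by (simp add: \<omega>_def min.coboundedI2)
    qed
  qed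
  then show ?thesis using \<sigma> a(1) by blast
qed

end

theorem theorem4:
  fixes n :: nat and L lam vmax vstar \<mu> :: real and V b :: "real \<Rightarrow> real"
  assumes "2 \<le> n"
    and "0 < L" and "L < lam"
    and "0 < vmax" and "0 < vstar" and "vstar < vmax"
    and "0 < \<mu>"
    and "C_k_on 3 V {L<..}"
    and "\<And>x. L < x \<Longrightarrow> 0 \<le> V x"
    and "filterlim V at_top (at_right L)"
    and "\<And>x. lam \<le> x \<Longrightarrow> V x = 0"
    and "\<And>x. L < x \<Longrightarrow> x < lam \<Longrightarrow> deriv V x < 0"
    and "\<And>x. L < x \<Longrightarrow> x < lam \<Longrightarrow> 0 < deriv (deriv V) x"
    and "C_k_on 2 b UNIV"
    and "\<And>x. vstar - vmax < b x \<and> b x < vstar"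
    and "strict_mono b"
    and "b 0 = 0"
    and "\<And>x. x \<noteq> 0 \<Longrightarrow> 0 < x * b x"
    and "0 < deriv b 0"
  shows "\<exists>\<sigma> a. class_KL \<sigma> \<and> class_K_inf a \<and>
    (\<forall>I s v. maximal_closed_loop_solution n L vmax vstar \<mu> V b I s v \<longrightarrow>
       I = {0..} \<and>
       (\<forall>t\<ge>0. a (dist_to n (s t, v t) (equilibria n lam vstar)) \<le> H_fun n vmax vstar V b (s t) (v t) \<and>
               H_fun n vmax vstar V b (s t) (v t) \<le> \<sigma> (H_fun n vmax vstar V b (s 0) (v 0)) t))"
proof -
  interpret open_road n L lam vmax vstar \<mu> V b
    by unfold_locales (use assms in auto)
  show ?thesis by (rule uniform_convergence)
qed

end
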